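(* Let $\mathcal{A}$ be a 2-category and $W:\mathcal{A}\to\mathcal{C}at$ a 2-functor. If $W$ is a PIE weight, then $(\mathcal{E}l_W,\Sigma)$ and $(\Gamma_W,\Sigma)$ are PIE indexing pairs, where in each case $\Sigma$ is the family of arrows of the form $(f,id)$.
   Context: **PIE weights.** A weight $W:\mathcal{A}\to\mathcal{C}at$ is PIE if, in the category with objects the pairs $(x,A)$, $A\in\mathcal{A}$, $x$ an object of $WA$, and arrows $(x,A)\to(y,B)$ the arrows $f:A\to B$ of $\mathcal{A}$ with $Wf(x)=y$, each connected component has an initial object. **2-categories of elements.** $\mathcal{E}l_W$ is the 2-category of elements (Grothendieck construction) of $W$: objects are pairs $(x,A)$ with $A\in\mathcal{A}$ and $x\in WA$; arrows $(x,A)\to(y,B)$ are pairs $(f,\varphi)$ with $f:A\to B$ in $\mathcal{A}$ and $\varphi:Wf(x)\to y$ in $WB$; 2-cells $(f,\varphi)\Rightarrow(g,\psi)$ are 2-cells $\gamma:f\Rightarrow g$ of $\mathcal{A}$ with $\psi\circ(W\gamma)_x=\varphi$. $\Gamma_W$ is the dual version: the same objects; arrows $(x,A)\to(y,B)$ are pairs $(f,\varphi)$ with $f:A\to B$ and $\varphi:y\to Wf(x)$ in $WB$; 2-cells $(f,\varphi)\Rightarrow(g,\psi)$ are 2-cells $\gamma:f\Rightarrow g$ with $(W\gamma)_x\circ\varphi=\psi$. **PIE indexing pairs.** An indexing pair $(\mathcal{C},\Sigma)$ is a 2-category $\mathcal{C}$ with a family $\Sigma$ of its arrows, closed under composition and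 containing all identities. It is PIE if, in the 1-subcategory of $\mathcal{C}$ given by all objects of $\mathcal{C}$ and the arrows of $\Sigma$, each connected component has an initial object. *)

theory Defs
  imports "HOL-Library.FuncSet"
begin

section \<open>Categories and connected components\<close>

text \<open>
  Categories have explicit carriers and total domain and codomain functions;
  \<open>g \<cdot>\<^bsub>C\<^esub> f\<close> is the composite of \<open>g\<close> after \<open>f\<close>, meaningful only when \<open>Cod C f = Dom C g\<close>.
\<close>

record ('o,'a) cat =
  Ob :: "'o set"
  Ar :: "'a set"
  Dom :: "'a \<Rightarrow> 'o"
  Cod :: "'a \<Rightarrow> 'o"
  Idn :: "'o \<Rightarrow> 'a"
  Cmp :: "'a \<Rightarrow> 'a \<Rightarrow> 'a" (infixr "\<cdot>\<index>" 70)

definition Hom :: "('o,'a,'z) cat_scheme \<Rightarrow> 'o \<Rightarrow> 'o \<Rightarrow> 'a set" where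
  "Hom C X Y = {f \<in> Ar C. Dom C f = X \<and> Cod C f = Y}"

locale category =
  fixes C :: "('o,'a,'z) cat_scheme" (structure)
  assumes Dom_Ob: "f \<in> Ar C \<Longrightarrow> Dom C f \<in> Ob C"
    and Cod_Ob: "f \<in> Ar C \<Longrightarrow> Cod C f \<in> Ob C"
    and Idn_Hom: "X \<in> Ob C \<Longrightarrow> Idn C X \<in> Hom C X X"
    and Cmp_Hom: "\<lbrakk>f \<in> Hom C X Y; g \<in> Hom C Y Z\<rbrakk> \<Longrightarrow> g \<cdot> f \<in> Hom C X Z"
    and Idn_Cmp: "f \<in> Hom C X Y \<Longrightarrow> Idn C Y \<cdot> f = f"
    and Cmp_Idn: "f \<in> Hom C X Y \<Longrightarrow> f \<cdot> Idn C X = f"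
    and Cmp_assoc: "\<lbrakk>f \<in> Hom C X Y; g \<in> Hom C Y Z; h \<in> Hom C Z V\<rbrakk>
                      \<Longrightarrow> (h \<cdot> g) \<cdot> f = h \<cdot> (g \<cdot> f)"

definition full_subcategory :: "('o,'a,'z) cat_scheme \<Rightarrow> 'o set \<Rightarrow> ('o,'a) cat" where
  "full_subcategory C K =
     \<lparr>Ob = K, Ar = {f \<in> Ar C. Dom C f \<in> K \<and> Cod C f \<in> K},
      Dom = Dom C, Cod = Cod C, Idn = Idn C, Cmp = Cmp C\<rparr>"

definition initial_object :: "('o,'a,'z) cat_scheme \<Rightarrow> 'o \<Rightarrow> bool" where
  "initial_object C I \<longleftrightarrow> I \<in> Ob C \<and> (\<forall>X \<in> Ob C. \<exists>!f. f \<in> Hom C I X)"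

text \<open>Two objects are connected if they are joined by a finite zigzag of arrows.\<close>

definition connected_rel :: "('o,'a,'z) cat_scheme \<Rightarrow> ('o \<times> 'o) set" where
  "connected_rel C =
     {(X,Y). X \<in> Ob C \<and> Y \<in> Ob C \<and>
        (X,Y) \<in> {(U,V). Hom C U V \<noteq> {} \<or> Hom C V U \<noteq> {}}\<^sup>*}"

definition components :: "('o,'a,'z) cat_scheme \<Rightarrow> 'o set set" where
  "components C = Ob C // connected_rel C"

definition components_have_initial :: "('o,'a,'z) cat_scheme \<Rightarrow> bool" where
  "components_have_initial C \<longleftrightarrow>
     (\<forall>K \<in> components C. \<exists>I. initial_object (full_subcategory C K) I)"

text \<open>Functoriality of an object map and an arrow map; only their values on the carriers matter.\<close>

locale functor_maps =
  S: category S + T: category T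
  for S :: "('o,'a,'z) cat_scheme" and T :: "('p,'b,'y) cat_scheme" +
  fixes Fo :: "'o \<Rightarrow> 'p" and Fa :: "'a \<Rightarrow> 'b"
  assumes Fo_Ob: "X \<in> Ob S \<Longrightarrow> Fo X \<in> Ob T"
    and Fa_Hom: "f \<in> Hom S X Y \<Longrightarrow> Fa f \<in> Hom T (Fo X) (Fo Y)"
    and Fa_Idn: "X \<in> Ob S \<Longrightarrow> Fa (Idn S X) = Idn T (Fo X)"
    and Fa_Cmp: "\<lbrakk>f \<in> Hom S X Y; g \<in> Hom S Y Z\<rbrakk> \<Longrightarrow> Fa (g \<cdot>\<^bsub>S\<^esub> f) = Fa g \<cdot>\<^bsub>T\<^esub> Fa f"


section \<open>Strict 2-categories and 2-functors\<close>

text \<open>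
  A 2-category is given by its underlying category, its category of arrows and 2-cells under
  vertical composition, and its category of objects and 2-cells under horizontal composition,
  subject to the compatibility conditions below.
\<close>

record ('o,'a,'c) two_cat = "('o,'a) cat" +
  Cell :: "'c set"
  Src :: "'c \<Rightarrow> 'a"
  Tgt :: "'c \<Rightarrow> 'a"
  VIdn :: "'a \<Rightarrow> 'c"
  VCmp :: "'c \<Rightarrow> 'c \<Rightarrow> 'c" (infixr "\<bullet>\<index>" 70)
  HCmp :: "'c \<Rightarrow> 'c \<Rightarrow> 'c" (infixr "\<star>\<index>" 70)

definition vertical :: "('o,'a,'c,'z) two_cat_scheme \<Rightarrow> ('a,'c) cat" where
  "vertical C = \<lparr>Ob = Ar C, Ar = Cell C, Dom = Src C, Cod = Tgt C, Idn = VIdn C, Cmp = VCmp C\<rparr>"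

definition horizontal :: "('o,'a,'c,'z) two_cat_scheme \<Rightarrow> ('o,'c) cat" where
  "horizontal C =
     \<lparr>Ob = Ob C, Ar = Cell C, Dom = (\<lambda>\<alpha>. Dom C (Src C \<alpha>)), Cod = (\<lambda>\<alpha>. Cod C (Src C \<alpha>)),
      Idn = (\<lambda>X. VIdn C (Idn C X)), Cmp = HCmp C\<rparr>"

locale two_category = category C
  for C :: "('o,'a,'c,'z) two_cat_scheme" (structure) +
  assumes vertical_category: "category (vertical C)"
    and horizontal_category: "category (horizontal C)"
    and Dom_Tgt: "\<alpha> \<in> Cell C \<Longrightarrow> Dom C (Tgt C \<alpha>) = Dom C (Src C \<alpha>)"
    and Cod_Tgt: "\<alpha> \<in> Cell C \<Longrightarrow> Cod C (Tgt C \<alpha>) = Cod C (Src C \<alpha>)"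
    and Src_HCmp: "\<lbrakk>\<alpha> \<in> Cell C; \<beta> \<in> Cell C; Dom C (Src C \<beta>) = Cod C (Src C \<alpha>)\<rbrakk>
                     \<Longrightarrow> Src C (\<beta> \<star> \<alpha>) = Src C \<beta> \<cdot> Src C \<alpha>"
    and Tgt_HCmp: "\<lbrakk>\<alpha> \<in> Cell C; \<beta> \<in> Cell C; Dom C (Src C \<beta>) = Cod C (Src C \<alpha>)\<rbrakk>
                     \<Longrightarrow> Tgt C (\<beta> \<star> \<alpha>) = Tgt C \<beta> \<cdot> Tgt C \<alpha>"
    and VIdn_HCmp: "\<lbrakk>f \<in> Ar C; g \<in> Ar C; Dom C g = Cod C f\<rbrakk>
                      \<Longrightarrow> VIdn C g \<star> VIdn C f = VIdn C (g \<cdot> f)"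
    and interchange: "\<lbrakk>\<alpha> \<in> Cell C; \<alpha>' \<in> Cell C; \<beta> \<in> Cell C; \<beta>' \<in> Cell C;
                        Src C \<alpha>' = Tgt C \<alpha>; Src C \<beta>' = Tgt C \<beta>;
                        Dom C (Src C \<beta>) = Cod C (Src C \<alpha>)\<rbrakk>
                      \<Longrightarrow> (\<beta>' \<bullet> \<beta>) \<star> (\<alpha>' \<bullet> \<alpha>) = (\<beta>' \<star> \<alpha>') \<bullet> (\<beta> \<star> \<alpha>)"

record ('o,'a,'c,'p,'b,'d) two_map =
  On0 :: "'o \<Rightarrow> 'p"
  On1 :: "'a \<Rightarrow> 'b"
  On2 :: "'c \<Rightarrow> 'd"

locale two_functor =
  S: two_category S + T: two_category T
  for S :: "('o,'a,'c,'z) two_cat_scheme" and T :: "('p,'b,'d,'y) two_cat_scheme" +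
  fixes F :: "('o,'a,'c,'p,'b,'d,'w) two_map_scheme"
  assumes functor_underlying: "functor_maps S T (On0 F) (On1 F)"
    and functor_vertical: "functor_maps (vertical S) (vertical T) (On1 F) (On2 F)"
    and functor_horizontal: "functor_maps (horizontal S) (horizontal T) (On0 F) (On2 F)"


section \<open>The 2-category of categories\<close>

text \<open>
  The categories whose objects and arrows are drawn from two fixed types form a 2-category.
  Functors carry their source and target, and all maps are extensional, so that equality of
  functors and of natural transformations is equality in the logic. The 2-category axioms for
  \<open>Cat\<close> are verified in the last section.
\<close>

record ('x,'y) fct =
  FDom :: "('x,'y) cat"
  FCod :: "('x,'y) cat"
  FOb :: "'x \<Rightarrow> 'x"
  FAr :: "'y \<Rightarrow> 'y"

definition is_fct :: "('x,'y) fct \<Rightarrow> bool" where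
  "is_fct F \<longleftrightarrow> functor_maps (FDom F) (FCod F) (FOb F) (FAr F) \<and>
     FOb F \<in> extensional (Ob (FDom F)) \<and> FAr F \<in> extensional (Ar (FDom F))"

definition fct_id :: "('x,'y) cat \<Rightarrow> ('x,'y) fct" where
  "fct_id C = \<lparr>FDom = C, FCod = C, FOb = (\<lambda>x\<in>Ob C. x), FAr = (\<lambda>u\<in>Ar C. u)\<rparr>"

definition fct_comp :: "('x,'y) fct \<Rightarrow> ('x,'y) fct \<Rightarrow> ('x,'y) fct" where
  "fct_comp G F = \<lparr>FDom = FDom F, FCod = FCod G,
     FOb = compose (Ob (FDom F)) (FOb G) (FOb F), FAr = compose (Ar (FDom F)) (FAr G) (FAr F)\<rparr>"

record ('x,'y) ntrans =
  NSrc :: "('x,'y) fct"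
  NTgt :: "('x,'y) fct"
  NAt :: "'x \<Rightarrow> 'y"

definition is_ntrans :: "('x,'y) ntrans \<Rightarrow> bool" where
  "is_ntrans \<alpha> \<longleftrightarrow>
     is_fct (NSrc \<alpha>) \<and> is_fct (NTgt \<alpha>) \<and>
     FDom (NTgt \<alpha>) = FDom (NSrc \<alpha>) \<and> FCod (NTgt \<alpha>) = FCod (NSrc \<alpha>) \<and>
     NAt \<alpha> \<in> extensional (Ob (FDom (NSrc \<alpha>))) \<and>
     (\<forall>x \<in> Ob (FDom (NSrc \<alpha>)). NAt \<alpha> x \<in> Hom (FCod (NSrc \<alpha>)) (FOb (NSrc \<alpha>) x) (FOb (NTgt \<alpha>) x)) \<and>
     (\<forall>x y. \<forall>u \<in> Hom (FDom (NSrc \<alpha>)) x y.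
        FAr (NTgt \<alpha>) u \<cdot>\<^bsub>FCod (NSrc \<alpha>)\<^esub> NAt \<alpha> x = NAt \<alpha> y \<cdot>\<^bsub>FCod (NSrc \<alpha>)\<^esub> FAr (NSrc \<alpha>) u)"

definition ntrans_id :: "('x,'y) fct \<Rightarrow> ('x,'y) ntrans" where
  "ntrans_id F = \<lparr>NSrc = F, NTgt = F, NAt = (\<lambda>x\<in>Ob (FDom F). Idn (FCod F) (FOb F x))\<rparr>"

definition ntrans_vcomp :: "('x,'y) ntrans \<Rightarrow> ('x,'y) ntrans \<Rightarrow> ('x,'y) ntrans" where
  "ntrans_vcomp \<beta> \<alpha> = \<lparr>NSrc = NSrc \<alpha>, NTgt = NTgt \<beta>,
     NAt = (\<lambda>x\<in>Ob (FDom (NSrc \<alpha>)). NAt \<beta> x \<cdot>\<^bsub>FCod (NSrc \<alpha>)\<^esub> NAt \<alpha> x)\<rparr>"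

definition ntrans_hcomp :: "('x,'y) ntrans \<Rightarrow> ('x,'y) ntrans \<Rightarrow> ('x,'y) ntrans" where
  "ntrans_hcomp \<beta> \<alpha> = \<lparr>NSrc = fct_comp (NSrc \<beta>) (NSrc \<alpha>), NTgt = fct_comp (NTgt \<beta>) (NTgt \<alpha>),
     NAt = (\<lambda>x\<in>Ob (FDom (NSrc \<alpha>)).
              NAt \<beta> (FOb (NTgt \<alpha>) x) \<cdot>\<^bsub>FCod (NSrc \<beta>)\<^esub> FAr (NSrc \<beta>) (NAt \<alpha> x))\<rparr>"

definition Cat :: "(('x,'y) cat, ('x,'y) fct, ('x,'y) ntrans) two_cat" where
  "Cat = \<lparr>Ob = {C. category C}, Ar = {F. is_fct F}, Dom = FDom, Cod = FCod,
          Idn = fct_id, Cmp = fct_comp,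
          Cell = {\<alpha>. is_ntrans \<alpha>}, Src = NSrc, Tgt = NTgt,
          VIdn = ntrans_id, VCmp = ntrans_vcomp, HCmp = ntrans_hcomp\<rparr>"


section \<open>PIE weights and 2-categories of elements\<close>

type_synonym ('o,'a,'c,'x,'y) weight =
  "('o,'a,'c,('x,'y) cat,('x,'y) fct,('x,'y) ntrans) two_map"

text \<open>
  A pair such as \<open>(f,\<phi>)\<close> does not determine the objects it goes between, so arrows and 2-cells
  of categories of elements are stored together with their source and target.
\<close>

datatype ('p,'b) framed = Framed (fsrc: 'p) (body: 'b) (ftgt: 'p)

definition elements_ob :: "('o,'a,'c) two_cat \<Rightarrow> ('o,'a,'c,'x,'y) weight \<Rightarrow> ('x \<times> 'o) set" where
  "elements_ob A W = {(x,a). a \<in> Ob A \<and> x \<in> Ob (On0 W a)}"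

definition elements_cat ::
  "('o,'a,'c) two_cat \<Rightarrow> ('o,'a,'c,'x,'y) weight \<Rightarrow> ('x \<times> 'o, ('x \<times> 'o, 'a) framed) cat" where
  "elements_cat A W =
     \<lparr>Ob = elements_ob A W,
      Ar = {Framed (x,a) f (y,b) | x a f y b.
              (x,a) \<in> elements_ob A W \<and> (y,b) \<in> elements_ob A W \<and>
              f \<in> Hom A a b \<and> FOb (On1 W f) x = y},
      Dom = fsrc, Cod = ftgt,
      Idn = (\<lambda>(x,a). Framed (x,a) (Idn A a) (x,a)),
      Cmp = (\<lambda>q p. Framed (fsrc p) (body q \<cdot>\<^bsub>A\<^esub> body p) (ftgt q))\<rparr>"

definition PIE_weight :: "('o,'a,'c) two_cat \<Rightarrow> ('o,'a,'c,'x,'y) weight \<Rightarrow> bool" where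
  "PIE_weight A W \<longleftrightarrow> components_have_initial (elements_cat A W)"

type_synonym ('o,'a,'x,'y) el_ar = "('x \<times> 'o, 'a \<times> 'y) framed"
type_synonym ('o,'a,'c,'x,'y) el_cell = "(('o,'a,'x,'y) el_ar, 'c) framed"

definition El_Ar :: "('o,'a,'c) two_cat \<Rightarrow> ('o,'a,'c,'x,'y) weight \<Rightarrow> ('o,'a,'x,'y) el_ar set" where
  "El_Ar A W = {Framed (x,a) (f,\<phi>) (y,b) | x a f \<phi> y b.
     (x,a) \<in> elements_ob A W \<and> (y,b) \<in> elements_ob A W \<and>
     f \<in> Hom A a b \<and> \<phi> \<in> Hom (On0 W b) (FOb (On1 W f) x) y}"

definition Gam_Ar :: "('o,'a,'c) two_cat \<Rightarrow> ('o,'a,'c,'x,'y) weight \<Rightarrow> ('o,'a,'x,'y) el_ar set" where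
  "Gam_Ar A W = {Framed (x,a) (f,\<phi>) (y,b) | x a f \<phi> y b.
     (x,a) \<in> elements_ob A W \<and> (y,b) \<in> elements_ob A W \<and>
     f \<in> Hom A a b \<and> \<phi> \<in> Hom (On0 W b) y (FOb (On1 W f) x)}"

definition el_idn ::
  "('o,'a,'c) two_cat \<Rightarrow> ('o,'a,'c,'x,'y) weight \<Rightarrow> 'x \<times> 'o \<Rightarrow> ('o,'a,'x,'y) el_ar" where
  "el_idn A W = (\<lambda>(x,a). Framed (x,a) (Idn A a, Idn (On0 W a) x) (x,a))"

text \<open>
  For \<open>(f,\<phi>) : (x,a) \<rightarrow> (y,b)\<close> and \<open>(g,\<psi>) : (y,b) \<rightarrow> (z,c)\<close>, the composite in \<open>El\<close> is
  \<open>(g f, \<psi> \<circ> Wg(\<phi>))\<close> and the composite in \<open>Gam\<close> is \<open>(g f, Wg(\<phi>) \<circ> \<psi>)\<close>.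
\<close>

fun El_cmp ::
  "('o,'a,'c) two_cat \<Rightarrow> ('o,'a,'c,'x,'y) weight
     \<Rightarrow> ('o,'a,'x,'y) el_ar \<Rightarrow> ('o,'a,'x,'y) el_ar \<Rightarrow> ('o,'a,'x,'y) el_ar" where
  "El_cmp A W (Framed yb (g,\<psi>) (z,c)) (Framed xa (f,\<phi>) yb') =
     Framed xa (g \<cdot>\<^bsub>A\<^esub> f, \<psi> \<cdot>\<^bsub>On0 W c\<^esub> FAr (On1 W g) \<phi>) (z,c)"

fun Gam_cmp ::
  "('o,'a,'c) two_cat \<Rightarrow> ('o,'a,'c,'x,'y) weight
     \<Rightarrow> ('o,'a,'x,'y) el_ar \<Rightarrow> ('o,'a,'x,'y) el_ar \<Rightarrow> ('o,'a,'x,'y) el_ar" where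
  "Gam_cmp A W (Framed yb (g,\<psi>) (z,c)) (Framed xa (f,\<phi>) yb') =
     Framed xa (g \<cdot>\<^bsub>A\<^esub> f, FAr (On1 W g) \<phi> \<cdot>\<^bsub>On0 W c\<^esub> \<psi>) (z,c)"

definition El_Cell ::
  "('o,'a,'c) two_cat \<Rightarrow> ('o,'a,'c,'x,'y) weight \<Rightarrow> ('o,'a,'c,'x,'y) el_cell set" where
  "El_Cell A W =
     {Framed (Framed (x,a) (f,\<phi>) (y,b)) \<gamma> (Framed (x,a) (g,\<psi>) (y,b)) | x a f \<phi> g \<psi> y b \<gamma>.
        Framed (x,a) (f,\<phi>) (y,b) \<in> El_Ar A W \<and> Framed (x,a) (g,\<psi>) (y,b) \<in> El_Ar A W \<and>
        \<gamma> \<in> Cell A \<and> Src A \<gamma> = f \<and> Tgt A \<gamma> = g \<and>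
        \<psi> \<cdot>\<^bsub>On0 W b\<^esub> NAt (On2 W \<gamma>) x = \<phi>}"

definition Gam_Cell ::
  "('o,'a,'c) two_cat \<Rightarrow> ('o,'a,'c,'x,'y) weight \<Rightarrow> ('o,'a,'c,'x,'y) el_cell set" where
  "Gam_Cell A W =
     {Framed (Framed (x,a) (f,\<phi>) (y,b)) \<gamma> (Framed (x,a) (g,\<psi>) (y,b)) | x a f \<phi> g \<psi> y b \<gamma>.
        Framed (x,a) (f,\<phi>) (y,b) \<in> Gam_Ar A W \<and> Framed (x,a) (g,\<psi>) (y,b) \<in> Gam_Ar A W \<and>
        \<gamma> \<in> Cell A \<and> Src A \<gamma> = f \<and> Tgt A \<gamma> = g \<and>
        NAt (On2 W \<gamma>) x \<cdot>\<^bsub>On0 W b\<^esub> \<phi> = \<psi>}"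

definition El ::
  "('o,'a,'c) two_cat \<Rightarrow> ('o,'a,'c,'x,'y) weight
     \<Rightarrow> ('x \<times> 'o, ('o,'a,'x,'y) el_ar, ('o,'a,'c,'x,'y) el_cell) two_cat" where
  "El A W =
     \<lparr>Ob = elements_ob A W, Ar = El_Ar A W, Dom = fsrc, Cod = ftgt,
      Idn = el_idn A W, Cmp = El_cmp A W,
      Cell = El_Cell A W, Src = fsrc, Tgt = ftgt,
      VIdn = (\<lambda>p. Framed p (VIdn A (fst (body p))) p),
      VCmp = (\<lambda>\<tau> \<sigma>. Framed (fsrc \<sigma>) (body \<tau> \<bullet>\<^bsub>A\<^esub> body \<sigma>) (ftgt \<tau>)),
      HCmp = (\<lambda>\<tau> \<sigma>. Framed (El_cmp A W (fsrc \<tau>) (fsrc \<sigma>)) (body \<tau> \<star>\<^bsub>A\<^esub> body \<sigma>)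
                            (El_cmp A W (ftgt \<tau>) (ftgt \<sigma>)))\<rparr>"

definition Gam ::
  "('o,'a,'c) two_cat \<Rightarrow> ('o,'a,'c,'x,'y) weight
     \<Rightarrow> ('x \<times> 'o, ('o,'a,'x,'y) el_ar, ('o,'a,'c,'x,'y) el_cell) two_cat" where
  "Gam A W =
     \<lparr>Ob = elements_ob A W, Ar = Gam_Ar A W, Dom = fsrc, Cod = ftgt,
      Idn = el_idn A W, Cmp = Gam_cmp A W,
      Cell = Gam_Cell A W, Src = fsrc, Tgt = ftgt,
      VIdn = (\<lambda>p. Framed p (VIdn A (fst (body p))) p),
      VCmp = (\<lambda>\<tau> \<sigma>. Framed (fsrc \<sigma>) (body \<tau> \<bullet>\<^bsub>A\<^esub> body \<sigma>) (ftgt \<tau>)),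
      HCmp = (\<lambda>\<tau> \<sigma>. Framed (Gam_cmp A W (fsrc \<tau>) (fsrc \<sigma>)) (body \<tau> \<star>\<^bsub>A\<^esub> body \<sigma>)
                            (Gam_cmp A W (ftgt \<tau>) (ftgt \<sigma>)))\<rparr>"

text \<open>
  The arrows \<open>(f,id)\<close> of \<open>C\<close>, where \<open>C\<close> is \<open>El A W\<close> or \<open>Gam A W\<close>. Since \<open>\<phi>\<close> goes between
  \<open>Wf(x)\<close> and \<open>y\<close>, in one direction or the other, it is an identity only if \<open>Wf(x) = y\<close>.
\<close>

definition id_arrows ::
  "('o,'a,'c,'x,'y) weight
     \<Rightarrow> ('x \<times> 'o, ('o,'a,'x,'y) el_ar, ('o,'a,'c,'x,'y) el_cell) two_cat
     \<Rightarrow> ('o,'a,'x,'y) el_ar set" where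
  "id_arrows W C = {Framed (x,a) (f,\<phi>) (y,b) | x a f \<phi> y b.
     Framed (x,a) (f,\<phi>) (y,b) \<in> Ar C \<and> (\<exists>z \<in> Ob (On0 W b). \<phi> = Idn (On0 W b) z)}"


section \<open>Indexing pairs\<close>

definition indexing_pair :: "('o,'a,'c) two_cat \<Rightarrow> 'a set \<Rightarrow> bool" where
  "indexing_pair C \<Sigma> \<longleftrightarrow> two_category C \<and> \<Sigma> \<subseteq> Ar C \<and>
     (\<forall>X \<in> Ob C. Idn C X \<in> \<Sigma>) \<and>
     (\<forall>f \<in> \<Sigma>. \<forall>g \<in> \<Sigma>. Dom C g = Cod C f \<longrightarrow> g \<cdot>\<^bsub>C\<^esub> f \<in> \<Sigma>)"

definition arrow_subcategory :: "('o,'a,'c) two_cat \<Rightarrow> 'a set \<Rightarrow> ('o,'a) cat" where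
  "arrow_subcategory C \<Sigma> =
     \<lparr>Ob = Ob C, Ar = \<Sigma>, Dom = Dom C, Cod = Cod C, Idn = Idn C, Cmp = Cmp C\<rparr>"

definition PIE_indexing_pair :: "('o,'a,'c) two_cat \<Rightarrow> 'a set \<Rightarrow> bool" where
  "PIE_indexing_pair C \<Sigma> \<longleftrightarrow>
     indexing_pair C \<Sigma> \<and> components_have_initial (arrow_subcategory C \<Sigma>)"


section \<open>\<open>Cat\<close> is a 2-category\<close>

lemma Hom_iff: "f \<in> Hom C X Y \<longleftrightarrow> f \<in> Ar C \<and> Dom C f = X \<and> Cod C f = Y"
  by (auto simp: Hom_def)

lemma functor_maps_comp:
  assumes F: "functor_maps C D Fo Fa" and G: "functor_maps D E Go Ga"
  shows "functor_maps C E (\<lambda>x. Go (Fo x)) (\<lambda>u. Ga (Fa u))"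
proof -
  interpret F: functor_maps C D Fo Fa by fact
  interpret G: functor_maps D E Go Ga by fact
  show ?thesis
    by unfold_locales
      (auto intro: F.Fo_Ob G.Fo_Ob F.Fa_Hom G.Fa_Hom
        simp: F.Fa_Idn G.Fa_Idn[OF F.Fo_Ob] F.Fa_Cmp G.Fa_Cmp[OF F.Fa_Hom F.Fa_Hom])
qed

lemma functor_maps_cong:
  assumes F: "functor_maps C D Fo Fa"
    and o: "\<And>x. x \<in> Ob C \<Longrightarrow> Go x = Fo x" and a: "\<And>u. u \<in> Ar C \<Longrightarrow> Ga u = Fa u"
  shows "functor_maps C D Go Ga"
proof -
  interpret F: functor_maps C D Fo Fa by fact
  have *: "u \<in> Ar C" "x \<in> Ob C" "y \<in> Ob C" if "u \<in> Hom C x y" for u x y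
    using that F.S.Dom_Ob F.S.Cod_Ob by (auto simp: Hom_iff)
  show ?thesis
  proof
    show "Go X \<in> Ob D" if "X \<in> Ob C" for X using that o F.Fo_Ob by simp
    show "Ga f \<in> Hom D (Go X) (Go Y)" if "f \<in> Hom C X Y" for f X Y
      using F.Fa_Hom[OF that] *[OF that] by (simp add: o a)
    show "Ga (Idn C X) = Idn D (Go X)" if "X \<in> Ob C" for X
      using F.Fa_Idn[OF that] F.S.Idn_Hom[OF that] that by (simp add: o a Hom_iff)
    show "Ga (g \<cdot>\<^bsub>C\<^esub> f) = Ga g \<cdot>\<^bsub>D\<^esub> Ga f" if "f \<in> Hom C X Y" "g \<in> Hom C Y Z" for f g X Y Z
      using F.Fa_Cmp[OF that] *[OF that(1)] *[OF that(2)] *[OF F.S.Cmp_Hom[OF that]] by (simp add: a)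
  qed
qed

lemma is_fct_id: "category C \<Longrightarrow> is_fct (fct_id C)"
proof -
  assume C: "category C"
  have "functor_maps C C (\<lambda>x. x) (\<lambda>u. u)"
    using C by (simp add: functor_maps_def functor_maps_axioms_def)
  from functor_maps_cong[OF this, of "FOb (fct_id C)" "FAr (fct_id C)"]
  show ?thesis unfolding is_fct_def by (simp add: fct_id_def)
qed

lemma is_fct_comp:
  assumes F: "is_fct F" and G: "is_fct G" and c: "FDom G = FCod F"
  shows "is_fct (fct_comp G F)"
proof -
  have "functor_maps (FDom F) (FCod G) (\<lambda>x. FOb G (FOb F x)) (\<lambda>u. FAr G (FAr F u))"
    using functor_maps_comp F G c unfolding is_fct_def by metis
  from functor_maps_cong[OF this, of "FOb (fct_comp G F)" "FAr (fct_comp G F)"]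
  show ?thesis unfolding is_fct_def by (simp add: fct_comp_def compose_def)
qed

lemma fct_eqI:
  assumes "is_fct F" "is_fct G" "FDom F = FDom G" "FCod F = FCod G"
    "\<And>x. x \<in> Ob (FDom G) \<Longrightarrow> FOb F x = FOb G x" "\<And>u. u \<in> Ar (FDom G) \<Longrightarrow> FAr F u = FAr G u"
  shows "F = G"
  using assms unfolding is_fct_def
  by (intro fct.equality) (auto intro: extensionalityI)

lemma ntrans_eqI:
  assumes "is_ntrans \<alpha>" "is_ntrans \<beta>" "NSrc \<alpha> = NSrc \<beta>" "NTgt \<alpha> = NTgt \<beta>"
    "\<And>x. x \<in> Ob (FDom (NSrc \<beta>)) \<Longrightarrow> NAt \<alpha> x = NAt \<beta> x"
  shows "\<alpha> = \<beta>"
  using assms unfolding is_ntrans_def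
  by (intro ntrans.equality) (auto intro: extensionalityI)

lemma is_fctD:
  assumes "is_fct F"
  shows "category (FDom F)" "category (FCod F)"
    "\<And>x. x \<in> Ob (FDom F) \<Longrightarrow> FOb F x \<in> Ob (FCod F)"
    "\<And>u x y. u \<in> Hom (FDom F) x y \<Longrightarrow> FAr F u \<in> Hom (FCod F) (FOb F x) (FOb F y)"
    "\<And>x. x \<in> Ob (FDom F) \<Longrightarrow> FAr F (Idn (FDom F) x) = Idn (FCod F) (FOb F x)"
    "\<And>u v x y z. u \<in> Hom (FDom F) x y \<Longrightarrow> v \<in> Hom (FDom F) y z \<Longrightarrow>
        FAr F (v \<cdot>\<^bsub>FDom F\<^esub> u) = FAr F v \<cdot>\<^bsub>FCod F\<^esub> FAr F u"
proof -
  interpret functor_maps "FDom F" "FCod F" "FOb F" "FAr F" using assms by (simp add: is_fct_def)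
  show "category (FDom F)" "category (FCod F)" by unfold_locales
qed (use assms in \<open>auto simp: is_fct_def intro: functor_maps.Fo_Ob functor_maps.Fa_Hom
       functor_maps.Fa_Idn functor_maps.Fa_Cmp\<close>)

lemma fct_Ar:
  assumes "is_fct F" "u \<in> Ar (FDom F)"
  shows "FAr F u \<in> Ar (FCod F)"
  using is_fctD(4)[OF assms(1), of u "Dom (FDom F) u" "Cod (FDom F) u"] assms(2) by (auto simp: Hom_iff)

lemma category_Cat: "category Cat"
proof
  fix f g h :: "('a,'b) fct" and X Y Z V :: "('a,'b) cat"
  show "f \<in> Ar Cat \<Longrightarrow> Dom Cat f \<in> Ob Cat" "f \<in> Ar Cat \<Longrightarrow> Cod Cat f \<in> Ob Cat"
    by (auto simp: Cat_def is_fctD)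
  show "X \<in> Ob Cat \<Longrightarrow> Idn Cat X \<in> Hom Cat X X"
    by (auto simp: Cat_def Hom_iff is_fct_id) (auto simp: fct_id_def)
  show "f \<in> Hom Cat X Y \<Longrightarrow> g \<in> Hom Cat Y Z \<Longrightarrow> g \<cdot>\<^bsub>Cat\<^esub> f \<in> Hom Cat X Z"
    by (auto simp: Cat_def Hom_iff is_fct_comp) (auto simp: fct_comp_def)
  show "Idn Cat Y \<cdot>\<^bsub>Cat\<^esub> f = f" if "f \<in> Hom Cat X Y"
  proof -
    have f: "is_fct f" and X: "FDom f = X" and Y: "FCod f = Y" using that by (auto simp: Cat_def Hom_iff)
    have "is_fct (fct_comp (fct_id Y) f)"
      by (intro is_fct_comp f is_fct_id) (use is_fctD(2)[OF f] Y in \<open>auto simp: fct_id_def\<close>)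
    then have "fct_comp (fct_id Y) f = f"
      by (rule fct_eqI) (use f Y in \<open>auto simp: fct_id_def fct_comp_def compose_def is_fctD fct_Ar\<close>)
    then show ?thesis by (simp add: Cat_def)
  qed
  show "f \<cdot>\<^bsub>Cat\<^esub> Idn Cat X = f" if "f \<in> Hom Cat X Y"
  proof -
    have f: "is_fct f" and X: "FDom f = X" and Y: "FCod f = Y" using that by (auto simp: Cat_def Hom_iff)
    have "is_fct (fct_comp f (fct_id X))"
      by (intro is_fct_comp f is_fct_id) (use is_fctD(1)[OF f] X in \<open>auto simp: fct_id_def\<close>)
    then have "fct_comp f (fct_id X) = f"
      by (rule fct_eqI) (use f X in \<open>auto simp: fct_id_def fct_comp_def compose_def is_fctD fct_Ar\<close>)
    then show ?thesis by (simp add: Cat_def)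
  qed
  show "(h \<cdot>\<^bsub>Cat\<^esub> g) \<cdot>\<^bsub>Cat\<^esub> f = h \<cdot>\<^bsub>Cat\<^esub> g \<cdot>\<^bsub>Cat\<^esub> f"
    if "f \<in> Hom Cat X Y" "g \<in> Hom Cat Y Z" "h \<in> Hom Cat Z V"
    using that by (auto simp: Cat_def Hom_iff fct_comp_def compose_def fun_eq_iff is_fctD fct_Ar)
qed

lemma is_ntransD:
  assumes "is_ntrans \<alpha>"
  shows "is_fct (NSrc \<alpha>)" "is_fct (NTgt \<alpha>)" "FDom (NTgt \<alpha>) = FDom (NSrc \<alpha>)" "FCod (NTgt \<alpha>) = FCod (NSrc \<alpha>)"
    "\<And>x. x \<in> Ob (FDom (NSrc \<alpha>)) \<Longrightarrow> NAt \<alpha> x \<in> Hom (FCod (NSrc \<alpha>)) (FOb (NSrc \<alpha>) x) (FOb (NTgt \<alpha>) x)"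
    "\<And>u x y. u \<in> Hom (FDom (NSrc \<alpha>)) x y \<Longrightarrow>
       FAr (NTgt \<alpha>) u \<cdot>\<^bsub>FCod (NSrc \<alpha>)\<^esub> NAt \<alpha> x = NAt \<alpha> y \<cdot>\<^bsub>FCod (NSrc \<alpha>)\<^esub> FAr (NSrc \<alpha>) u"
  using assms unfolding is_ntrans_def by auto

lemma Hom_Ob: "category C \<Longrightarrow> u \<in> Hom C x y \<Longrightarrow> x \<in> Ob C \<and> y \<in> Ob C \<and> u \<in> Ar C"
  by (auto simp: Hom_iff category.Dom_Ob category.Cod_Ob)

lemma is_ntrans_id: assumes F: "is_fct F" shows "is_ntrans (ntrans_id F)"
proof -
  note c = is_fctD[OF F]
  have "FAr F u \<cdot>\<^bsub>FCod F\<^esub> Idn (FCod F) (FOb F x) = Idn (FCod F) (FOb F y) \<cdot>\<^bsub>FCod F\<^esub> FAr F u"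
    if "u \<in> Hom (FDom F) x y" for u x y
    using category.Idn_Cmp[OF c(2) c(4)[OF that]] category.Cmp_Idn[OF c(2) c(4)[OF that]] by simp
  then show ?thesis
    unfolding is_ntrans_def ntrans_id_def
    using F Hom_Ob[OF c(1)] category.Idn_Hom[OF c(2) c(3)] by auto
qed

lemma is_ntrans_vcomp:
  assumes a: "is_ntrans \<alpha>" and b: "is_ntrans \<beta>" and e: "NSrc \<beta> = NTgt \<alpha>"
  shows "is_ntrans (ntrans_vcomp \<beta> \<alpha>)"
proof -
  define S T C D where d: "S = NSrc \<alpha>" "T = NTgt \<beta>" "C = FDom S" "D = FCod S"
  note A = is_ntransD[OF a] note B = is_ntransD[OF b, unfolded e A]
  have D: "category D" "category C" using A(1) d is_fctD by auto
  have n: "FAr T u \<cdot>\<^bsub>D\<^esub> (NAt \<beta> x \<cdot>\<^bsub>D\<^esub> NAt \<alpha> x) = (NAt \<beta> y \<cdot>\<^bsub>D\<^esub> NAt \<alpha> y) \<cdot>\<^bsub>D\<^esub> FAr S u"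
    if u: "u \<in> Hom C x y" for u x y
  proof -
    have o: "x \<in> Ob C" "y \<in> Ob C" using Hom_Ob[OF D(2) u] by auto
    note ax = A(5)[folded d, OF o(1)] and ay = A(5)[folded d, OF o(2)]
    note bx = B(5)[folded d, OF o(1)] and ey = B(5)[folded d, OF o(2)]
    have Su: "FAr S u \<in> Hom D (FOb S x) (FOb S y)" using is_fctD(4)[OF A(1)] u by (auto simp: d)
    have Tu: "FAr T u \<in> Hom D (FOb T x) (FOb T y)" using is_fctD(4)[OF B(2)] u B(3,4) by (auto simp: d)
    have Mu: "FAr (NTgt \<alpha>) u \<in> Hom D (FOb (NTgt \<alpha>) x) (FOb (NTgt \<alpha>) y)" using is_fctD(4)[OF A(2)] u A(3,4) by (auto simp: d)
    have "FAr T u \<cdot>\<^bsub>D\<^esub> (NAt \<beta> x \<cdot>\<^bsub>D\<^esub> NAt \<alpha> x) = (NAt \<beta> y \<cdot>\<^bsub>D\<^esub> FAr (NTgt \<alpha>) u) \<cdot>\<^bsub>D\<^esub> NAt \<alpha> x"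
      using category.Cmp_assoc[OF D(1) ax bx Tu] B(6)[folded d, OF u] by simp
    also have "\<dots> = (NAt \<beta> y \<cdot>\<^bsub>D\<^esub> NAt \<alpha> y) \<cdot>\<^bsub>D\<^esub> FAr S u"
      using category.Cmp_assoc[OF D(1) ax Mu ey] A(6)[folded d, OF u] category.Cmp_assoc[OF D(1) Su ay ey] by simp
    finally show ?thesis .
  qed
  have h: "NAt \<beta> x \<cdot>\<^bsub>D\<^esub> NAt \<alpha> x \<in> Hom D (FOb S x) (FOb T x)" if "x \<in> Ob C" for x
    using category.Cmp_Hom[OF D(1) A(5)[folded d, OF that] B(5)[folded d, OF that]] .
  show ?thesis unfolding is_ntrans_def ntrans_vcomp_def
    using A(1-4) B(1-4) n h Hom_Ob[OF D(2)] by (auto simp: d)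
qed

lemma is_ntrans_hcomp:
  assumes a: "is_ntrans \<alpha>" and b: "is_ntrans \<beta>" and e: "FDom (NSrc \<beta>) = FCod (NSrc \<alpha>)"
  shows "is_ntrans (ntrans_hcomp \<beta> \<alpha>)"
proof -
  define F G K L C D E where d: "F = NSrc \<alpha>" "G = NTgt \<alpha>" "K = NSrc \<beta>" "L = NTgt \<beta>" "C = FDom F" "D = FCod F" "E = FCod K"
  have e': "FDom K = D" using e d by simp
  note A = is_ntransD[OF a, folded d] note B = is_ntransD[OF b, folded d, unfolded e', folded d]
  have cats: "category C" "category D" "category E" using A B d is_fctD by auto
  have ob: "FOb F x \<in> Ob D" "FOb G x \<in> Ob D" if "x \<in> Ob C" for x
    using is_fctD(3)[OF A(1)] is_fctD(3)[OF A(2)] that A(3,4) by (auto simp: d)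
  have Kh: "FAr K v \<in> Hom E (FOb K x) (FOb K y)" if "v \<in> Hom D x y" for v x y
    using is_fctD(4)[OF B(1), unfolded e', folded d] that by auto
  have Lh: "FAr L v \<in> Hom E (FOb L x) (FOb L y)" if "v \<in> Hom D x y" for v x y
    using is_fctD(4)[OF B(2), unfolded B(3,4)] that by auto
  have Fh: "FAr F v \<in> Hom D (FOb F x) (FOb F y)" if "v \<in> Hom C x y" for v x y
    using is_fctD(4)[OF A(1), folded d] that by auto
  have Gh: "FAr G v \<in> Hom D (FOb G x) (FOb G y)" if "v \<in> Hom C x y" for v x y
    using is_fctD(4)[OF A(2), unfolded A(3,4)] that by auto
  have n: "FAr L (FAr G u) \<cdot>\<^bsub>E\<^esub> (NAt \<beta> (FOb G x) \<cdot>\<^bsub>E\<^esub> FAr K (NAt \<alpha> x))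
        = (NAt \<beta> (FOb G y) \<cdot>\<^bsub>E\<^esub> FAr K (NAt \<alpha> y)) \<cdot>\<^bsub>E\<^esub> FAr K (FAr F u)"
    if u: "u \<in> Hom C x y" for u x y
  proof -
    have o: "x \<in> Ob C" "y \<in> Ob C" using Hom_Ob[OF cats(1) u] by auto
    note ax = A(5)[OF o(1)] and ay = A(5)[OF o(2)]
    note bx = B(5)[OF ob(2)[OF o(1)]] and ey = B(5)[OF ob(2)[OF o(2)]]
    have "FAr L (FAr G u) \<cdot>\<^bsub>E\<^esub> (NAt \<beta> (FOb G x) \<cdot>\<^bsub>E\<^esub> FAr K (NAt \<alpha> x))
      = (NAt \<beta> (FOb G y) \<cdot>\<^bsub>E\<^esub> FAr K (FAr G u)) \<cdot>\<^bsub>E\<^esub> FAr K (NAt \<alpha> x)"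
      using category.Cmp_assoc[OF cats(3) Kh[OF ax] bx Lh[OF Gh[OF u]]] B(6)[OF Gh[OF u]] by simp
    also have "\<dots> = NAt \<beta> (FOb G y) \<cdot>\<^bsub>E\<^esub> FAr K (FAr G u \<cdot>\<^bsub>D\<^esub> NAt \<alpha> x)"
      using category.Cmp_assoc[OF cats(3) Kh[OF ax] Kh[OF Gh[OF u]] ey]
        is_fctD(6)[OF B(1), unfolded e', folded d, OF ax Gh[OF u]] by simp
    also have "\<dots> = NAt \<beta> (FOb G y) \<cdot>\<^bsub>E\<^esub> (FAr K (NAt \<alpha> y) \<cdot>\<^bsub>E\<^esub> FAr K (FAr F u))"
      using A(6)[OF u] is_fctD(6)[OF B(1), unfolded e', folded d, OF Fh[OF u] ay] by simp
    also have "\<dots> = (NAt \<beta> (FOb G y) \<cdot>\<^bsub>E\<^esub> FAr K (NAt \<alpha> y)) \<cdot>\<^bsub>E\<^esub> FAr K (FAr F u)"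
      using category.Cmp_assoc[OF cats(3) Kh[OF Fh[OF u]] Kh[OF ay] ey] by simp
    finally show ?thesis .
  qed
  have h: "NAt \<beta> (FOb G x) \<cdot>\<^bsub>E\<^esub> FAr K (NAt \<alpha> x) \<in> Hom E (FOb K (FOb F x)) (FOb L (FOb G x))" if "x \<in> Ob C" for x
    using category.Cmp_Hom[OF cats(3) Kh[OF A(5)] B(5)[OF ob(2)]] that by auto
  have KF: "is_fct (fct_comp K F)" "is_fct (fct_comp L G)"
    using is_fct_comp[OF A(1) B(1)] is_fct_comp[OF A(2) B(2)] e' A(4) B(3) d by auto
  have s: "Ob (FDom F) = Ob C" "FDom F = C" "FCod K = E" using d by auto
  show ?thesis unfolding is_ntrans_def ntrans_hcomp_def d[symmetric]
    using KF n h Hom_Ob[OF cats(1)] A(3,4) B(3,4) s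
    by (auto simp: fct_comp_def compose_def)
qed

lemma vertical_Cat: "category (vertical Cat)"
proof
  fix f g h :: "('a,'b) ntrans" and X Y Z V :: "('a,'b) fct"
  note defs = vertical_def Cat_def Hom_iff
  show "f \<in> Ar (vertical Cat) \<Longrightarrow> Dom (vertical Cat) f \<in> Ob (vertical Cat)" "f \<in> Ar (vertical Cat) \<Longrightarrow> Cod (vertical Cat) f \<in> Ob (vertical Cat)"
    by (auto simp: defs is_ntransD)
  show "X \<in> Ob (vertical Cat) \<Longrightarrow> Idn (vertical Cat) X \<in> Hom (vertical Cat) X X"
    by (auto simp: defs is_ntrans_id) (auto simp: ntrans_id_def)
  show "f \<in> Hom (vertical Cat) X Y \<Longrightarrow> g \<in> Hom (vertical Cat) Y Z \<Longrightarrow> g \<cdot>\<^bsub>vertical Cat\<^esub> f \<in> Hom (vertical Cat) X Z"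
    by (auto simp: defs is_ntrans_vcomp) (auto simp: ntrans_vcomp_def)
  show "Idn (vertical Cat) Y \<cdot>\<^bsub>vertical Cat\<^esub> f = f" if "f \<in> Hom (vertical Cat) X Y"
  proof -
    have f: "is_ntrans f" and X: "NSrc f = X" and Y: "NTgt f = Y" using that by (auto simp: defs)
    note F = is_ntransD[OF f, unfolded X Y]
    have "is_ntrans (ntrans_vcomp (ntrans_id Y) f)"
      by (intro is_ntrans_vcomp f is_ntrans_id F) (simp add: ntrans_id_def Y)
    then have "ntrans_vcomp (ntrans_id Y) f = f"
      by (rule ntrans_eqI) (use f X Y F category.Idn_Cmp[OF is_fctD(2)[OF F(1)] F(5)] in \<open>auto simp: ntrans_id_def ntrans_vcomp_def\<close>)
    then show ?thesis by (simp add: defs)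
  qed
  show "f \<cdot>\<^bsub>vertical Cat\<^esub> Idn (vertical Cat) X = f" if "f \<in> Hom (vertical Cat) X Y"
  proof -
    have f: "is_ntrans f" and X: "NSrc f = X" and Y: "NTgt f = Y" using that by (auto simp: defs)
    note F = is_ntransD[OF f, unfolded X Y]
    have "is_ntrans (ntrans_vcomp f (ntrans_id X))"
      by (intro is_ntrans_vcomp f is_ntrans_id F) (simp add: ntrans_id_def X)
    then have "ntrans_vcomp f (ntrans_id X) = f"
      by (rule ntrans_eqI) (use f X Y F category.Cmp_Idn[OF is_fctD(2)[OF F(1)] F(5)] in \<open>auto simp: ntrans_id_def ntrans_vcomp_def\<close>)
    then show ?thesis by (simp add: defs)
  qed
  show "(h \<cdot>\<^bsub>vertical Cat\<^esub> g) \<cdot>\<^bsub>vertical Cat\<^esub> f = h \<cdot>\<^bsub>vertical Cat\<^esub> g \<cdot>\<^bsub>vertical Cat\<^esub> f"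
    if "f \<in> Hom (vertical Cat) X Y" "g \<in> Hom (vertical Cat) Y Z" "h \<in> Hom (vertical Cat) Z V"
  proof -
    have f: "is_ntrans f" "NSrc f = X" "NTgt f = Y"
     and g: "is_ntrans g" "NSrc g = Y" "NTgt g = Z"
     and h: "is_ntrans h" "NSrc h = Z" "NTgt h = V" using that by (auto simp: defs)
    note F = is_ntransD[OF f(1), unfolded f] note G = is_ntransD[OF g(1), unfolded g F] 
    note H = is_ntransD[OF h(1), unfolded h G F]
    show ?thesis
      using category.Cmp_assoc[OF is_fctD(2)[OF F(1)] F(5) G(5) H(5)] f g h F G H
      by (auto simp: defs ntrans_vcomp_def fun_eq_iff)
  qed
qed

lemma horizontal_Cat: "category (horizontal Cat)"
proof
  fix f g h :: "('a,'b) ntrans" and X Y Z V :: "('a,'b) cat"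
  note defs = horizontal_def Cat_def Hom_iff
  let ?H = "horizontal Cat"
  show "f \<in> Ar ?H \<Longrightarrow> Dom ?H f \<in> Ob ?H" "f \<in> Ar ?H \<Longrightarrow> Cod ?H f \<in> Ob ?H"
    by (auto simp: defs is_ntransD is_fctD)
  show "X \<in> Ob ?H \<Longrightarrow> Idn ?H X \<in> Hom ?H X X"
    by (auto simp: defs is_ntrans_id is_fct_id) (auto simp: ntrans_id_def fct_id_def)
  show "f \<in> Hom ?H X Y \<Longrightarrow> g \<in> Hom ?H Y Z \<Longrightarrow> g \<cdot>\<^bsub>?H\<^esub> f \<in> Hom ?H X Z"
    by (auto simp: defs is_ntrans_hcomp) (auto simp: ntrans_hcomp_def fct_comp_def)
  show "Idn ?H Y \<cdot>\<^bsub>?H\<^esub> f = f" if "f \<in> Hom ?H X Y"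
  proof -
    have f: "is_ntrans f" and X: "FDom (NSrc f) = X" and Y: "FCod (NSrc f) = Y" using that by (auto simp: defs)
    note F = is_ntransD[OF f, unfolded X Y]
    have Y': "category Y" and i: "is_fct (fct_id Y)" using is_fctD(2)[OF F(1)] Y is_fct_id by auto
    have n: "is_ntrans (ntrans_hcomp (ntrans_id (fct_id Y)) f)"
      by (intro is_ntrans_hcomp f is_ntrans_id i) (simp add: ntrans_id_def fct_id_def Y)
    have s: "fct_comp (fct_id Y) (NSrc f) = NSrc f" "fct_comp (fct_id Y) (NTgt f) = NTgt f"
      using category.Idn_Cmp[OF category_Cat, of "NSrc f" X Y] category.Idn_Cmp[OF category_Cat, of "NTgt f" X Y]
       F X Y by (auto simp: Cat_def Hom_iff)
    have "ntrans_hcomp (ntrans_id (fct_id Y)) f = f"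
    proof (rule ntrans_eqI[OF n f])
      show "NSrc (ntrans_hcomp (ntrans_id (fct_id Y)) f) = NSrc f" "NTgt (ntrans_hcomp (ntrans_id (fct_id Y)) f) = NTgt f"
        by (simp_all add: ntrans_hcomp_def ntrans_id_def s)
      fix x assume "x \<in> Ob (FDom (NSrc f))"
      then have x: "x \<in> Ob X" by (simp add: X)
      have "FOb (NTgt f) x \<in> Ob Y" "NAt f x \<in> Ar Y" using Hom_Ob[OF Y' F(5)[OF x]] by auto
      then show "NAt (ntrans_hcomp (ntrans_id (fct_id Y)) f) x = NAt f x"
        using x X category.Idn_Cmp[OF Y' F(5)[OF x]] by (simp add: ntrans_hcomp_def ntrans_id_def fct_id_def)
    qed
    then show ?thesis by (simp add: defs)
  qed
  show "f \<cdot>\<^bsub>?H\<^esub> Idn ?H X = f" if "f \<in> Hom ?H X Y"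
  proof -
    have f: "is_ntrans f" and X: "FDom (NSrc f) = X" and Y: "FCod (NSrc f) = Y" using that by (auto simp: defs)
    note F = is_ntransD[OF f, unfolded X Y]
    have X': "category X" and i: "is_fct (fct_id X)" using is_fctD(1)[OF F(1)] X is_fct_id by auto
    have Y': "category Y" using is_fctD(2)[OF F(1)] Y by auto
    have n: "is_ntrans (ntrans_hcomp f (ntrans_id (fct_id X)))"
      by (intro is_ntrans_hcomp f is_ntrans_id i) (simp add: ntrans_id_def fct_id_def X)
    have s: "fct_comp (NSrc f) (fct_id X) = NSrc f" "fct_comp (NTgt f) (fct_id X) = NTgt f"
      using category.Cmp_Idn[OF category_Cat, of "NSrc f" X Y] category.Cmp_Idn[OF category_Cat, of "NTgt f" X Y]
       F X Y by (auto simp: Cat_def Hom_iff)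
    have "ntrans_hcomp f (ntrans_id (fct_id X)) = f"
    proof (rule ntrans_eqI[OF n f])
      show "NSrc (ntrans_hcomp f (ntrans_id (fct_id X))) = NSrc f" "NTgt (ntrans_hcomp f (ntrans_id (fct_id X))) = NTgt f"
        by (simp_all add: ntrans_hcomp_def ntrans_id_def s)
      fix x assume "x \<in> Ob (FDom (NSrc f))"
      then have x: "x \<in> Ob X" by (simp add: X)
      show "NAt (ntrans_hcomp f (ntrans_id (fct_id X))) x = NAt f x"
        using x X Y category.Idn_Hom[OF X' x] category.Cmp_Idn[OF Y' F(5)[OF x]] is_fctD(5)[OF F(1), unfolded X Y, OF x]
        by (simp add: ntrans_hcomp_def ntrans_id_def fct_id_def Hom_iff)
    qed
    then show ?thesis by (simp add: defs)
  qed
  show "(h \<cdot>\<^bsub>?H\<^esub> g) \<cdot>\<^bsub>?H\<^esub> f = h \<cdot>\<^bsub>?H\<^esub> g \<cdot>\<^bsub>?H\<^esub> f"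
    if "f \<in> Hom ?H X Y" "g \<in> Hom ?H Y Z" "h \<in> Hom ?H Z V"
  proof -
    have f: "is_ntrans f" "FDom (NSrc f) = X" "FCod (NSrc f) = Y"
     and g: "is_ntrans g" "FDom (NSrc g) = Y" "FCod (NSrc g) = Z"
     and h: "is_ntrans h" "FDom (NSrc h) = Z" "FCod (NSrc h) = V" using that by (auto simp: defs)
    note F = is_ntransD[OF f(1), unfolded f] note G = is_ntransD[OF g(1), unfolded g]
    note H = is_ntransD[OF h(1), unfolded h]
    have s: "fct_comp (fct_comp (NSrc h) (NSrc g)) (NSrc f) = fct_comp (NSrc h) (fct_comp (NSrc g) (NSrc f))"
        "fct_comp (fct_comp (NTgt h) (NTgt g)) (NTgt f) = fct_comp (NTgt h) (fct_comp (NTgt g) (NTgt f))"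
      using category.Cmp_assoc[OF category_Cat, of "NSrc f" X Y "NSrc g" Z "NSrc h" V]
        category.Cmp_assoc[OF category_Cat, of "NTgt f" X Y "NTgt g" Z "NTgt h" V] F G H f g h
      by (auto simp: Cat_def Hom_iff)
    have lhs: "is_ntrans (ntrans_hcomp (ntrans_hcomp h g) f)"
      by (intro is_ntrans_hcomp f g h) (auto simp: f g h ntrans_hcomp_def fct_comp_def)
    have rhs: "is_ntrans (ntrans_hcomp h (ntrans_hcomp g f))"
      by (intro is_ntrans_hcomp f g h) (auto simp: f g h ntrans_hcomp_def fct_comp_def)
    have "ntrans_hcomp (ntrans_hcomp h g) f = ntrans_hcomp h (ntrans_hcomp g f)"
    proof (rule ntrans_eqI[OF lhs rhs])
      show "NSrc (ntrans_hcomp (ntrans_hcomp h g) f) = NSrc (ntrans_hcomp h (ntrans_hcomp g f))"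
        "NTgt (ntrans_hcomp (ntrans_hcomp h g) f) = NTgt (ntrans_hcomp h (ntrans_hcomp g f))"
        by (simp_all add: ntrans_hcomp_def s)
      fix x assume "x \<in> Ob (FDom (NSrc (ntrans_hcomp h (ntrans_hcomp g f))))"
      then have x: "x \<in> Ob X" by (simp add: ntrans_hcomp_def fct_comp_def f)
      have V: "category V" and Y: "category Y" using is_fctD(2)[OF H(1)] is_fctD(2)[OF F(1)] h f by auto
      note fx = F(5)[OF x]
      have y: "FOb (NTgt f) x \<in> Ob Y" using Hom_Ob[OF Y fx] by auto
      note gy = G(5)[OF y]
      have z: "FOb (NTgt g) (FOb (NTgt f) x) \<in> Ob Z" using Hom_Ob[OF is_fctD(2)[OF G(1)]] gy g by auto
      note hz = H(5)[OF z]
      note Gf = is_fctD(4)[OF G(1), unfolded g, OF fx]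
      have gyz: "NAt g (FOb (NTgt f) x) \<cdot>\<^bsub>Z\<^esub> FAr (NSrc g) (NAt f x) \<in> Ar Z"
        using category.Cmp_Hom[OF is_fctD(1)[OF H(1), unfolded h] Gf gy] by (simp add: Hom_iff)
      note Hgf = is_fctD(6)[OF H(1), unfolded h, OF Gf gy]
      have as: "(NAt h (FOb (NTgt g) (FOb (NTgt f) x)) \<cdot>\<^bsub>V\<^esub> FAr (NSrc h) (NAt g (FOb (NTgt f) x))) \<cdot>\<^bsub>V\<^esub> FAr (NSrc h) (FAr (NSrc g) (NAt f x))
        = NAt h (FOb (NTgt g) (FOb (NTgt f) x)) \<cdot>\<^bsub>V\<^esub> (FAr (NSrc h) (NAt g (FOb (NTgt f) x)) \<cdot>\<^bsub>V\<^esub> FAr (NSrc h) (FAr (NSrc g) (NAt f x)))"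
        using category.Cmp_assoc[OF V is_fctD(4)[OF H(1), unfolded h, OF Gf] is_fctD(4)[OF H(1), unfolded h, OF gy] hz] .
      have ar: "NAt f x \<in> Ar Y" using fx by (simp add: Hom_iff)
      show "NAt (ntrans_hcomp (ntrans_hcomp h g) f) x = NAt (ntrans_hcomp h (ntrans_hcomp g f)) x"
        using x y as ar Hgf f g h F(3,4)
        by (simp add: ntrans_hcomp_def fct_comp_def compose_def)
    qed
    then show ?thesis by (simp add: defs)
  qed
qed

lemma interchange_Cat:
  assumes a: "is_ntrans \<alpha>" and a': "is_ntrans \<alpha>'" and b: "is_ntrans \<beta>" and b': "is_ntrans \<beta>'"
    and sa: "NSrc \<alpha>' = NTgt \<alpha>" and sb: "NSrc \<beta>' = NTgt \<beta>" and e: "FDom (NSrc \<beta>) = FCod (NSrc \<alpha>)"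
  shows "ntrans_hcomp (ntrans_vcomp \<beta>' \<beta>) (ntrans_vcomp \<alpha>' \<alpha>)
       = ntrans_vcomp (ntrans_hcomp \<beta>' \<alpha>') (ntrans_hcomp \<beta> \<alpha>)"
proof -
  define C D E where d: "C = FDom (NSrc \<alpha>)" "D = FCod (NSrc \<alpha>)" "E = FCod (NSrc \<beta>)"
  have e': "FDom (NSrc \<beta>) = D" using e d by simp
  note A = is_ntransD[OF a, folded d] note B = is_ntransD[OF b, unfolded e', folded d]
  note A' = is_ntransD[OF a', unfolded sa A(3,4)] note B' = is_ntransD[OF b', unfolded sb B(3,4)]
  have lhs: "is_ntrans (ntrans_hcomp (ntrans_vcomp \<beta>' \<beta>) (ntrans_vcomp \<alpha>' \<alpha>))"
    by (intro is_ntrans_hcomp is_ntrans_vcomp assms) (auto simp: ntrans_vcomp_def e)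
  have rhs: "is_ntrans (ntrans_vcomp (ntrans_hcomp \<beta>' \<alpha>') (ntrans_hcomp \<beta> \<alpha>))"
    by (intro is_ntrans_hcomp is_ntrans_vcomp assms) (use A B in \<open>auto simp: ntrans_hcomp_def e' sa sb d\<close>)
  have E: "category E" and D: "category D" using is_fctD A(1) B(1) d by auto
  show ?thesis
  proof (rule ntrans_eqI[OF lhs rhs])
    fix x assume "x \<in> Ob (FDom (NSrc (ntrans_vcomp (ntrans_hcomp \<beta>' \<alpha>') (ntrans_hcomp \<beta> \<alpha>))))"
    then have x: "x \<in> Ob C" by (simp add: d ntrans_hcomp_def ntrans_vcomp_def fct_comp_def)
    define p q r where o: "p = FOb (NSrc \<alpha>) x" "q = FOb (NTgt \<alpha>) x" "r = FOb (NTgt \<alpha>') x"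
    note h1 = A(5)[OF x, folded o] note h2 = A'(5)[OF x, folded o]
    have ob: "p \<in> Ob D" "q \<in> Ob D" "r \<in> Ob D" using Hom_Ob[OF D h1] Hom_Ob[OF D h2] by auto
    define K L M where k: "K = NSrc \<beta>" "L = NTgt \<beta>" "M = NTgt \<beta>'"
    have cod: "FDom K = D" "FDom L = D" "FCod K = E" "FCod L = E" using B e' d by (auto simp: k)
    note Kf = is_fctD(4)[OF B(1), folded k, unfolded cod] note Lf = is_fctD(4)[OF B(2), folded k, unfolded cod]
    note Kc = is_fctD(6)[OF B(1), folded k, unfolded cod]
    note br = B(5)[OF ob(3), folded k] note br' = B'(5)[OF ob(3), folded k]
    note bq = B(5)[OF ob(2), folded k]
    let ?c = "\<lambda>u v. u \<cdot>\<^bsub>E\<^esub> v"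
    have nat: "?c (FAr L (NAt \<alpha>' x)) (NAt \<beta> q) = ?c (NAt \<beta> r) (FAr K (NAt \<alpha>' x))"
      using B(6)[OF h2, folded k] .
    have "?c (?c (NAt \<beta>' r) (NAt \<beta> r)) (FAr K (NAt \<alpha>' x \<cdot>\<^bsub>D\<^esub> NAt \<alpha> x))
       = ?c (?c (NAt \<beta>' r) (NAt \<beta> r)) (?c (FAr K (NAt \<alpha>' x)) (FAr K (NAt \<alpha> x)))"
      using Kc[OF h1 h2] by simp
    also have "\<dots> = ?c (NAt \<beta>' r) (?c (NAt \<beta> r) (?c (FAr K (NAt \<alpha>' x)) (FAr K (NAt \<alpha> x))))"
      using category.Cmp_assoc[OF E category.Cmp_Hom[OF E Kf[OF h1] Kf[OF h2]] br br'] .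
    also have "\<dots> = ?c (NAt \<beta>' r) (?c (?c (NAt \<beta> r) (FAr K (NAt \<alpha>' x))) (FAr K (NAt \<alpha> x)))"
      using category.Cmp_assoc[OF E Kf[OF h1] Kf[OF h2] br] by simp
    also have "\<dots> = ?c (NAt \<beta>' r) (?c (FAr L (NAt \<alpha>' x)) (?c (NAt \<beta> q) (FAr K (NAt \<alpha> x))))"
      using category.Cmp_assoc[OF E Kf[OF h1] bq Lf[OF h2]] nat by simp
    also have "\<dots> = ?c (?c (NAt \<beta>' r) (FAr L (NAt \<alpha>' x))) (?c (NAt \<beta> q) (FAr K (NAt \<alpha> x)))"
      using category.Cmp_assoc[OF E category.Cmp_Hom[OF E Kf[OF h1] bq] Lf[OF h2] br'] by simp
    finally have eq: "?c (?c (NAt \<beta>' r) (NAt \<beta> r)) (FAr K (NAt \<alpha>' x \<cdot>\<^bsub>D\<^esub> NAt \<alpha> x))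
       = ?c (?c (NAt \<beta>' r) (FAr L (NAt \<alpha>' x))) (?c (NAt \<beta> q) (FAr K (NAt \<alpha> x)))" .
    show "NAt (ntrans_hcomp (ntrans_vcomp \<beta>' \<beta>) (ntrans_vcomp \<alpha>' \<alpha>)) x
       = NAt (ntrans_vcomp (ntrans_hcomp \<beta>' \<alpha>') (ntrans_hcomp \<beta> \<alpha>)) x"
      using eq x ob cod A(3,4) e'
      by (simp add: ntrans_hcomp_def ntrans_vcomp_def fct_comp_def sa sb d[symmetric] k[symmetric] o[symmetric])
  qed (auto simp: ntrans_hcomp_def ntrans_vcomp_def)
qed

lemma two_category_Cat: "two_category Cat"
proof (intro two_category.intro two_category_axioms.intro category_Cat vertical_Cat horizontal_Cat)
  fix f g :: "('a,'b) fct"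
  assume fg: "f \<in> Ar Cat" "g \<in> Ar Cat" "Dom Cat g = Cod Cat f"
  have f: "is_fct f" and g: "is_fct g" and e: "FDom g = FCod f" using fg by (auto simp: Cat_def)
  have "ntrans_hcomp (ntrans_id g) (ntrans_id f) = ntrans_id (fct_comp g f)"
  proof (rule ntrans_eqI)
    show "is_ntrans (ntrans_hcomp (ntrans_id g) (ntrans_id f))"
      by (intro is_ntrans_hcomp is_ntrans_id f g) (simp add: ntrans_id_def e)
    show "is_ntrans (ntrans_id (fct_comp g f))" by (intro is_ntrans_id is_fct_comp f g e)
    fix x assume "x \<in> Ob (FDom (NSrc (ntrans_id (fct_comp g f))))"
    then have x: "x \<in> Ob (FDom f)" by (simp add: ntrans_id_def fct_comp_def)
    note y = is_fctD(3)[OF f x]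
    note z = is_fctD(3)[OF g, unfolded e, OF y]
    show "NAt (ntrans_hcomp (ntrans_id g) (ntrans_id f)) x = NAt (ntrans_id (fct_comp g f)) x"
      using x y is_fctD(5)[OF g, unfolded e, OF y] category.Idn_Cmp[OF is_fctD(2)[OF g] category.Idn_Hom[OF is_fctD(2)[OF g] z]] e
      by (simp add: ntrans_hcomp_def ntrans_id_def fct_comp_def compose_def)
  qed (auto simp: ntrans_hcomp_def ntrans_id_def)
  then show "VIdn Cat g \<star>\<^bsub>Cat\<^esub> VIdn Cat f = VIdn Cat (g \<cdot>\<^bsub>Cat\<^esub> f)" by (simp add: Cat_def)
qed (auto simp: Cat_def is_ntransD interchange_Cat, auto simp: ntrans_hcomp_def)

end

theory Submission
  imports Defs
begin

text \<open>
  The 2-cells of \<open>El\<close> and \<open>Gam\<close> are 2-cells of \<open>A\<close> satisfying a condition on their framing arrows,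
  so the 2-category axioms reduce to the category axioms for arrows together with closure of that
  condition under identities and both compositions; for horizontal composites closure is naturality
  of \<open>W\<beta>\<close>. An arrow \<open>(f,id)\<close> from \<open>(x,a)\<close> to \<open>(y,b)\<close> amounts to an \<open>f\<close> with \<open>Wf(x) = y\<close>, so
  in both cases the subcategory of these arrows is isomorphic, over the identity on objects, to the
  ordinary category of elements, whose components have initial objects because \<open>W\<close> is PIE.
\<close>

section \<open>2-categories whose 2-cells are framed 2-cells of \<open>A\<close>\<close>

text \<open>A framed cell is determined by its two frames and its body, so each equational axiom
  splits in three: the frames obey the laws of arrows in \<open>C\<close>, the body obeys the law of
  2-cells in \<open>A\<close>. The functor \<open>P\<close> matches the identities and composites of
  frames with those of their images in \<open>A\<close>. What remains, and is assumed, is that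
  \<open>Cell C\<close> is closed under the operations.\<close>

lemma two_category_framed_cells:
  fixes C :: "('p,'q,('q,'c) framed) two_cat" and A :: "('o,'a,'c,'z) two_cat_scheme"
  assumes A: "two_category A" and P: "functor_maps C A Po Pa"
    and ops: "Src C = fsrc" "Tgt C = ftgt" "VIdn C = (\<lambda>p. Framed p (VIdn A (Pa p)) p)"
      "VCmp C = (\<lambda>\<tau> \<sigma>. Framed (fsrc \<sigma>) (body \<tau> \<bullet>\<^bsub>A\<^esub> body \<sigma>) (ftgt \<tau>))"
      "HCmp C = (\<lambda>\<tau> \<sigma>. Framed (fsrc \<tau> \<cdot>\<^bsub>C\<^esub> fsrc \<sigma>) (body \<tau> \<star>\<^bsub>A\<^esub> body \<sigma>) (ftgt \<tau> \<cdot>\<^bsub>C\<^esub> ftgt \<sigma>))"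
    and cell: "\<And>\<sigma>. \<sigma> \<in> Cell C \<Longrightarrow> fsrc \<sigma> \<in> Ar C \<and> ftgt \<sigma> \<in> Ar C \<and>
      Dom C (ftgt \<sigma>) = Dom C (fsrc \<sigma>) \<and> Cod C (ftgt \<sigma>) = Cod C (fsrc \<sigma>) \<and>
      body \<sigma> \<in> Hom (vertical A) (Pa (fsrc \<sigma>)) (Pa (ftgt \<sigma>))"
    and VIdn: "\<And>p. p \<in> Ar C \<Longrightarrow> VIdn C p \<in> Cell C"
    and VCmp: "\<And>\<sigma> \<tau>. \<lbrakk>\<sigma> \<in> Cell C; \<tau> \<in> Cell C; fsrc \<tau> = ftgt \<sigma>\<rbrakk> \<Longrightarrow> \<tau> \<bullet>\<^bsub>C\<^esub> \<sigma> \<in> Cell C"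
    and HCmp: "\<And>\<sigma> \<tau>. \<lbrakk>\<sigma> \<in> Cell C; \<tau> \<in> Cell C; Dom C (fsrc \<tau>) = Cod C (fsrc \<sigma>)\<rbrakk>
      \<Longrightarrow> \<tau> \<star>\<^bsub>C\<^esub> \<sigma> \<in> Cell C"
  shows "two_category C"
proof -
  interpret A: two_category A by fact
  interpret P: functor_maps C A Po Pa by fact
  interpret V: category "vertical A" by (rule A.vertical_category)
  interpret H: category "horizontal A" by (rule A.horizontal_category)
  have ar: "Pa p \<in> Hom A (Po (Dom C p)) (Po (Cod C p))" if "p \<in> Ar C" for p
    using that P.Fa_Hom by (auto simp: Hom_iff)
  \<comment> \<open>The ends of a body in \<open>horizontal A\<close> are those of its source arrow
    \<open>Pa (fsrc \<sigma>)\<close>; as \<open>P\<close> is a functor they are the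
    \<open>Po\<close>-images of the ends of the frame.\<close>
  have hor: "body \<sigma> \<in> Hom (horizontal A) (Po (Dom C (fsrc \<sigma>))) (Po (Cod C (fsrc \<sigma>)))"
    if "\<sigma> \<in> Cell C" for \<sigma>
    using cell[OF that] ar[of "fsrc \<sigma>"] by (auto simp: Hom_iff vertical_def horizontal_def)
  have vcat: "category (vertical C)"
  proof
    fix f g h X Y Z V
    let ?V = "vertical C"
    note defs = vertical_def Hom_iff ops
    show "f \<in> Ar ?V \<Longrightarrow> Dom ?V f \<in> Ob ?V" "f \<in> Ar ?V \<Longrightarrow> Cod ?V f \<in> Ob ?V"
      using cell[of f] by (auto simp: defs)
    show "X \<in> Ob ?V \<Longrightarrow> Idn ?V X \<in> Hom ?V X X"
      using VIdn[of X] by (auto simp: defs)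
    show "f \<in> Hom ?V X Y \<Longrightarrow> g \<in> Hom ?V Y Z \<Longrightarrow> g \<cdot>\<^bsub>?V\<^esub> f \<in> Hom ?V X Z"
      using VCmp[of f g] by (auto simp: defs)
    \<comment> \<open>Vertical units leave both frames as they are, so only the bodies need a unit
      law; \<open>framed.expand\<close> compares field by field.\<close>
    show "Idn ?V Y \<cdot>\<^bsub>?V\<^esub> f = f" "f \<cdot>\<^bsub>?V\<^esub> Idn ?V X = f" if f: "f \<in> Hom ?V X Y"
      using f cell[of f] V.Idn_Cmp[of "body f"] V.Cmp_Idn[of "body f"]
      by (auto simp: defs intro: framed.expand)
    show "(h \<cdot>\<^bsub>?V\<^esub> g) \<cdot>\<^bsub>?V\<^esub> f = h \<cdot>\<^bsub>?V\<^esub> g \<cdot>\<^bsub>?V\<^esub> f"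
      if f: "f \<in> Hom ?V X Y" and g: "g \<in> Hom ?V Y Z" and h: "h \<in> Hom ?V Z V"
      using f g h cell[of f] cell[of g] cell[of h] V.Cmp_assoc[of "body f" _ _ "body g" _ "body h"]
      by (auto simp: defs)
  qed
  have hcat: "category (horizontal C)"
  proof
    fix f g h X Y Z V
    let ?H = "horizontal C"
    note defs = horizontal_def Hom_iff ops
    show "f \<in> Ar ?H \<Longrightarrow> Dom ?H f \<in> Ob ?H" "f \<in> Ar ?H \<Longrightarrow> Cod ?H f \<in> Ob ?H"
      using cell[of f] P.S.Dom_Ob P.S.Cod_Ob by (auto simp: defs)
    show "X \<in> Ob ?H \<Longrightarrow> Idn ?H X \<in> Hom ?H X X"
      using VIdn[of "Idn C X"] P.S.Idn_Hom[of X] by (auto simp: defs)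
    show "g \<cdot>\<^bsub>?H\<^esub> f \<in> Hom ?H X Z" if f: "f \<in> Hom ?H X Y" and g: "g \<in> Hom ?H Y Z"
      using f g HCmp[of f g] cell[of f] cell[of g] P.S.Cmp_Hom[of "fsrc f" X Y "fsrc g" Z]
      by (auto simp: defs)
    show "Idn ?H Y \<cdot>\<^bsub>?H\<^esub> f = f" "f \<cdot>\<^bsub>?H\<^esub> Idn ?H X = f" if f: "f \<in> Hom ?H X Y"
    proof -
      have F: "f \<in> Cell C" "Dom C (fsrc f) = X" "Cod C (fsrc f) = Y" using f by (auto simp: defs)
      note c = cell[OF F(1)]
      have o: "X \<in> Ob C" "Y \<in> Ob C" using c F P.S.Dom_Ob P.S.Cod_Ob by auto
      have fs: "fsrc f \<in> Hom C X Y" "ftgt f \<in> Hom C X Y" using c F by (auto simp: Hom_iff)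
      \<comment> \<open>By \<open>P.Fa_Idn\<close> the body of the horizontal unit of
        \<open>C\<close> at \<open>Y\<close> is the horizontal unit of \<open>A\<close> at
        \<open>Po Y\<close>. The frames are handled by the unit laws of \<open>C\<close>, applied to
        source and target frame alike.\<close>
      have b: "VIdn A (Idn A (Po Y)) \<star>\<^bsub>A\<^esub> body f = body f"
        "body f \<star>\<^bsub>A\<^esub> VIdn A (Idn A (Po X)) = body f"
        using H.Idn_Cmp[OF hor[OF F(1)]] H.Cmp_Idn[OF hor[OF F(1)]] F by (auto simp: horizontal_def)
      show "Idn ?H Y \<cdot>\<^bsub>?H\<^esub> f = f" "f \<cdot>\<^bsub>?H\<^esub> Idn ?H X = f"
        using b fs[THEN P.S.Idn_Cmp] fs[THEN P.S.Cmp_Idn] P.Fa_Idn o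
        by (auto simp: defs intro: framed.expand)
    qed
    show "(h \<cdot>\<^bsub>?H\<^esub> g) \<cdot>\<^bsub>?H\<^esub> f = h \<cdot>\<^bsub>?H\<^esub> g \<cdot>\<^bsub>?H\<^esub> f"
      if f: "f \<in> Hom ?H X Y" and g: "g \<in> Hom ?H Y Z" and h: "h \<in> Hom ?H Z V"
    proof -
      have F: "f \<in> Cell C" "Dom C (fsrc f) = X" "Cod C (fsrc f) = Y"
        and G: "g \<in> Cell C" "Dom C (fsrc g) = Y" "Cod C (fsrc g) = Z"
        and H: "h \<in> Cell C" "Dom C (fsrc h) = Z" "Cod C (fsrc h) = V"
        using f g h by (auto simp: defs)
      have "(body h \<star>\<^bsub>A\<^esub> body g) \<star>\<^bsub>A\<^esub> body f = body h \<star>\<^bsub>A\<^esub> body g \<star>\<^bsub>A\<^esub> body f"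
        using H.Cmp_assoc[of "body f" "Po X" "Po Y" "body g" "Po Z" "body h" "Po V"]
          hor[OF F(1)] hor[OF G(1)] hor[OF H(1)] F G H by (simp add: horizontal_def)
      then show ?thesis
        \<comment> \<open>Associativity is used three times: in \<open>C\<close> for each of the two
          frames, and in \<open>horizontal A\<close> for the body.\<close>
        using P.S.Cmp_assoc[of "fsrc f" X Y "fsrc g" Z "fsrc h" V]
          P.S.Cmp_assoc[of "ftgt f" X Y "ftgt g" Z "ftgt h" V]
          cell[OF F(1)] cell[OF G(1)] cell[OF H(1)] F G H by (simp add: defs)
    qed
  qed
  show ?thesis
  proof (intro two_category.intro two_category_axioms.intro P.S.category_axioms vcat hcat)
    fix f g assume "f \<in> Ar C" "g \<in> Ar C" "Dom C g = Cod C f"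
    then show "VIdn C g \<star>\<^bsub>C\<^esub> VIdn C f = VIdn C (g \<cdot>\<^bsub>C\<^esub> f)"
      using ar[of f] ar[of g] A.VIdn_HCmp[of "Pa f" "Pa g"] P.Fa_Cmp[of f _ _ g]
      by (auto simp: ops Hom_iff)
  next
    fix \<alpha> \<alpha>' \<beta> \<beta>'
    assume c: "\<alpha> \<in> Cell C" "\<alpha>' \<in> Cell C" "\<beta> \<in> Cell C" "\<beta>' \<in> Cell C"
      and e: "Src C \<alpha>' = Tgt C \<alpha>" "Src C \<beta>' = Tgt C \<beta>" "Dom C (Src C \<beta>) = Cod C (Src C \<alpha>)"
    \<comment> \<open>Only the bodies need interchange: on both sides the source frame is the
      composite of the sources of \<open>\<beta>\<close> and \<open>\<alpha>\<close>, and the target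
      frame that of the targets of \<open>\<beta>'\<close> and \<open>\<alpha>'\<close>.\<close>
    have "(body \<beta>' \<bullet>\<^bsub>A\<^esub> body \<beta>) \<star>\<^bsub>A\<^esub> (body \<alpha>' \<bullet>\<^bsub>A\<^esub> body \<alpha>)
        = (body \<beta>' \<star>\<^bsub>A\<^esub> body \<alpha>') \<bullet>\<^bsub>A\<^esub> (body \<beta> \<star>\<^bsub>A\<^esub> body \<alpha>)"
      using c[THEN cell] e hor[OF c(1)] hor[OF c(3)]
      by (intro A.interchange) (auto simp: ops Hom_iff vertical_def horizontal_def)
    then show "(\<beta>' \<bullet>\<^bsub>C\<^esub> \<beta>) \<star>\<^bsub>C\<^esub> (\<alpha>' \<bullet>\<^bsub>C\<^esub> \<alpha>) = (\<beta>' \<star>\<^bsub>C\<^esub> \<alpha>') \<bullet>\<^bsub>C\<^esub> (\<beta> \<star>\<^bsub>C\<^esub> \<alpha>)"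
      by (simp add: ops)
  qed (use cell in \<open>auto simp: ops\<close>)
qed

section \<open>Transfer of initial objects of components\<close>

text \<open>Zigzags depend only on which hom-sets are inhabited, and initiality only on which are
  singletons. Bijections of hom-sets over a common set of objects preserve both.\<close>

lemma components_have_initial_transfer:
  fixes C :: "('o,'a,'z) cat_scheme" and D :: "('o,'b,'y) cat_scheme"
  assumes Ob: "Ob D = Ob C" and k: "\<And>X Y. bij_betw k (Hom C X Y) (Hom D X Y)"
    and init: "components_have_initial C"
  shows "components_have_initial D"
proof -
  have "Hom D X Y = {} \<longleftrightarrow> Hom C X Y = {}" for X Y
    using bij_betw_empty1 bij_betw_empty2 k by metis
  then have comp: "components D = components C"
    by (simp add: components_def connected_rel_def Ob)
  have hom: "f \<in> Hom (full_subcategory B K) X Y \<longleftrightarrow> f \<in> Hom B X Y \<and> X \<in> K \<and> Y \<in> K"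
    for f X Y K and B :: "('p,'q,'w) cat_scheme"
    by (auto simp: full_subcategory_def Hom_iff)
  have ex1: "\<exists>!g. g \<in> Hom D X Y" if "\<exists>!f. f \<in> Hom C X Y" for X Y
  proof -
    obtain f where "Hom C X Y = {f}" using \<open>\<exists>!f. f \<in> Hom C X Y\<close> by blast
    then have "Hom D X Y = {k f}" using k[of X Y] by (auto simp: bij_betw_def)
    then show ?thesis by auto
  qed
  have "initial_object (full_subcategory D K) I" if "initial_object (full_subcategory C K) I" for K I
  proof -
    have I: "\<exists>!f. f \<in> Hom C I X" if "X \<in> K" for X
      using \<open>initial_object (full_subcategory C K) I\<close> that
      unfolding initial_object_def hom by (auto simp: full_subcategory_def)
    have "I \<in> K"
      using that by (simp add: initial_object_def full_subcategory_def)
    then show ?thesis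
      using ex1[OF I] unfolding initial_object_def hom by (simp add: full_subcategory_def)
  qed
  then show ?thesis
    using init unfolding components_have_initial_def comp by blast
qed


section \<open>Pointwise description of a weight\<close>

text \<open>Arrows and 2-cells of \<open>Cat\<close> are records, so functoriality of
  \<open>W\<close> yields equations between records. The lemmas of this locale turn them into
  equations at single objects and arrows of the fibres \<open>On0 W a\<close>, the form in which the
  computations below use them.\<close>

locale weighted_two_category = two_functor A Cat W
  for A :: "('o,'a,'c) two_cat" and W :: "('o,'a,'c,'x,'y) weight"
begin

abbreviation "wt_ob f \<equiv> FOb (On1 W f)"
abbreviation "wt_ar f \<equiv> FAr (On1 W f)"
abbreviation "wt_at \<gamma> \<equiv> NAt (On2 W \<gamma>)"

sublocale U: functor_maps A Cat "On0 W" "On1 W" by (rule functor_underlying)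
sublocale V: functor_maps "vertical A" "vertical Cat" "On1 W" "On2 W" by (rule functor_vertical)
sublocale H: functor_maps "horizontal A" "horizontal Cat" "On0 W" "On2 W"
  by (rule functor_horizontal)

lemma wt_category: "a \<in> Ob A \<Longrightarrow> category (On0 W a)"
  using U.Fo_Ob by (auto simp: Cat_def)

lemma wt_fct:
  assumes "f \<in> Hom A a b"
  shows "is_fct (On1 W f)" "FDom (On1 W f) = On0 W a" "FCod (On1 W f) = On0 W b"
  using U.Fa_Hom[OF assms] by (auto simp: Cat_def Hom_iff)

lemma wt_ob:
  assumes "f \<in> Hom A a b" "x \<in> Ob (On0 W a)"
  shows "wt_ob f x \<in> Ob (On0 W b)"
  using is_fctD(3)[OF wt_fct(1)[OF assms(1)]] wt_fct(2,3)[OF assms(1)] assms(2) by simp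

lemma wt_ar:
  assumes "f \<in> Hom A a b" "u \<in> Hom (On0 W a) x y"
  shows "wt_ar f u \<in> Hom (On0 W b) (wt_ob f x) (wt_ob f y)"
  using is_fctD(4)[OF wt_fct(1)[OF assms(1)]] wt_fct(2,3)[OF assms(1)] assms(2) by simp

lemma wt_ar_Idn:
  assumes "f \<in> Hom A a b" "x \<in> Ob (On0 W a)"
  shows "wt_ar f (Idn (On0 W a) x) = Idn (On0 W b) (wt_ob f x)"
  using is_fctD(5)[OF wt_fct(1)[OF assms(1)]] wt_fct(2,3)[OF assms(1)] assms(2) by simp

lemma wt_ar_Cmp:
  assumes "f \<in> Hom A a b" "u \<in> Hom (On0 W a) x y" "v \<in> Hom (On0 W a) y z"
  shows "wt_ar f (v \<cdot>\<^bsub>On0 W a\<^esub> u) = wt_ar f v \<cdot>\<^bsub>On0 W b\<^esub> wt_ar f u"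
  using is_fctD(6)[OF wt_fct(1)[OF assms(1)]] wt_fct(2,3)[OF assms(1)] assms(2,3) by simp

text \<open>The maps of \<open>fct_id\<close> are restricted to the carriers, so they agree with the
  identity only under the membership premises.\<close>

lemma wt_Idn:
  assumes "a \<in> Ob A"
  shows "x \<in> Ob (On0 W a) \<Longrightarrow> wt_ob (Idn A a) x = x"
    and "u \<in> Hom (On0 W a) x y \<Longrightarrow> wt_ar (Idn A a) u = u"
  using U.Fa_Idn[OF assms] by (auto simp: Cat_def fct_id_def Hom_iff)

lemma wt_Cmp:
  assumes "f \<in> Hom A a b" "g \<in> Hom A b c"
  shows "x \<in> Ob (On0 W a) \<Longrightarrow> wt_ob (g \<cdot>\<^bsub>A\<^esub> f) x = wt_ob g (wt_ob f x)"
    and "u \<in> Hom (On0 W a) x y \<Longrightarrow> wt_ar (g \<cdot>\<^bsub>A\<^esub> f) u = wt_ar g (wt_ar f u)"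
  using U.Fa_Cmp[OF assms] wt_fct[OF assms(1)]
  by (auto simp: Cat_def fct_comp_def compose_def Hom_iff)

lemma vertical_Hom_iff:
  "\<gamma> \<in> Hom (vertical A) f g \<longleftrightarrow> \<gamma> \<in> Cell A \<and> Src A \<gamma> = f \<and> Tgt A \<gamma> = g"
  by (simp add: vertical_def Hom_iff)

lemma wt_ntrans:
  assumes "\<gamma> \<in> Hom (vertical A) f g"
  shows "is_ntrans (On2 W \<gamma>)" "NSrc (On2 W \<gamma>) = On1 W f" "NTgt (On2 W \<gamma>) = On1 W g"
  using V.Fa_Hom[OF assms] by (auto simp: vertical_def Cat_def Hom_iff)

lemma wt_at:
  assumes "\<gamma> \<in> Hom (vertical A) f g" "f \<in> Hom A a b" "x \<in> Ob (On0 W a)"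
  shows "wt_at \<gamma> x \<in> Hom (On0 W b) (wt_ob f x) (wt_ob g x)"
  using is_ntransD(5)[OF wt_ntrans(1)[OF assms(1)]] wt_ntrans(2,3)[OF assms(1)]
    wt_fct[OF assms(2)] assms(3) by simp

lemma wt_natural:
  assumes "\<gamma> \<in> Hom (vertical A) f g" "f \<in> Hom A a b" "u \<in> Hom (On0 W a) x y"
  shows "wt_ar g u \<cdot>\<^bsub>On0 W b\<^esub> wt_at \<gamma> x = wt_at \<gamma> y \<cdot>\<^bsub>On0 W b\<^esub> wt_ar f u"
  using is_ntransD(6)[OF wt_ntrans(1)[OF assms(1)]] wt_ntrans(2,3)[OF assms(1)]
    wt_fct[OF assms(2)] assms(3) by simp

lemma wt_at_VIdn:
  assumes "f \<in> Hom A a b" "x \<in> Ob (On0 W a)"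
  shows "wt_at (VIdn A f) x = Idn (On0 W b) (wt_ob f x)"
  using V.Fa_Idn[of f] assms wt_fct[OF assms(1)]
  by (simp add: vertical_def Cat_def ntrans_id_def Hom_iff)

lemma wt_at_VCmp:
  assumes "\<gamma> \<in> Hom (vertical A) f g" "\<delta> \<in> Hom (vertical A) g h" "f \<in> Hom A a b" "x \<in> Ob (On0 W a)"
  shows "wt_at (\<delta> \<bullet>\<^bsub>A\<^esub> \<gamma>) x = wt_at \<delta> x \<cdot>\<^bsub>On0 W b\<^esub> wt_at \<gamma> x"
  using V.Fa_Cmp[OF assms(1,2)] wt_ntrans[OF assms(1)] wt_fct[OF assms(3)] assms(4)
  by (simp add: vertical_def Cat_def ntrans_vcomp_def)

text \<open>\<open>W\<close> is functorial on \<open>horizontal A\<close>, and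
  \<open>ntrans_hcomp\<close> composes by first applying the source functor of the outer
  transformation and then taking its component at the target of the inner one; hence
  \<open>g\<close> and \<open>f'\<close> on the right.\<close>

lemma wt_at_HCmp:
  assumes "\<alpha> \<in> Hom (vertical A) f f'" "\<beta> \<in> Hom (vertical A) g g'"
    and "f \<in> Hom A a b" "g \<in> Hom A b c" "x \<in> Ob (On0 W a)"
  shows "wt_at (\<beta> \<star>\<^bsub>A\<^esub> \<alpha>) x = wt_at \<beta> (wt_ob f' x) \<cdot>\<^bsub>On0 W c\<^esub> wt_ar g (wt_at \<alpha> x)"
proof -
  have "\<alpha> \<in> Hom (horizontal A) a b" "\<beta> \<in> Hom (horizontal A) b c"
    using assms(1-4) by (auto simp: vertical_def horizontal_def Hom_iff)
  from H.Fa_Cmp[OF this] show ?thesis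
    using wt_ntrans[OF assms(1)] wt_ntrans[OF assms(2)] wt_fct[OF assms(3)] wt_fct[OF assms(4)]
      assms(5)
    by (simp add: horizontal_def Cat_def ntrans_hcomp_def)
qed

text \<open>\<open>W\<close> sends the identity of \<open>a\<close> to a functor fixing
  \<open>x\<close>, so the identity of \<open>x\<close> has the type required of a fibre component
  in \<open>El\<close> and in \<open>Gam\<close> alike.\<close>

lemma el_idn_Hom:
  assumes "a \<in> Ob A" "x \<in> Ob (On0 W a)"
  shows "Idn (On0 W a) x \<in> Hom (On0 W a) (wt_ob (Idn A a) x) x"
    and "Idn (On0 W a) x \<in> Hom (On0 W a) x (wt_ob (Idn A a) x)"
  using category.Idn_Hom[OF wt_category[OF assms(1)] assms(2)] wt_Idn(1)[OF assms] by simp_all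


section \<open>The 2-categories of elements\<close>

lemma El_Ar_iff [simp]:
  "Framed (x,a) (f,\<phi>) (y,b) \<in> El_Ar A W \<longleftrightarrow>
     a \<in> Ob A \<and> x \<in> Ob (On0 W a) \<and> b \<in> Ob A \<and> y \<in> Ob (On0 W b) \<and>
     f \<in> Hom A a b \<and> \<phi> \<in> Hom (On0 W b) (wt_ob f x) y"
  by (auto simp: El_Ar_def elements_ob_def)

lemma Gam_Ar_iff [simp]:
  "Framed (x,a) (f,\<phi>) (y,b) \<in> Gam_Ar A W \<longleftrightarrow>
     a \<in> Ob A \<and> x \<in> Ob (On0 W a) \<and> b \<in> Ob A \<and> y \<in> Ob (On0 W b) \<and>
     f \<in> Hom A a b \<and> \<phi> \<in> Hom (On0 W b) y (wt_ob f x)"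
  by (auto simp: Gam_Ar_def elements_ob_def)

lemma El_simps [simp]:
  "Ob (El A W) = elements_ob A W" "Ar (El A W) = El_Ar A W" "Dom (El A W) = fsrc"
  "Cod (El A W) = ftgt" "Idn (El A W) = el_idn A W" "Cmp (El A W) = El_cmp A W"
  by (simp_all add: El_def)

lemma El_Hom_iff: "p \<in> Hom (El A W) X Y \<longleftrightarrow> p \<in> El_Ar A W \<and> fsrc p = X \<and> ftgt p = Y"
  by (simp add: Hom_iff)

lemma El_HomE:
  assumes "p \<in> Hom (El A W) (x,a) (y,b)"
  obtains f \<phi> where "p = Framed (x,a) (f,\<phi>) (y,b)" "a \<in> Ob A" "x \<in> Ob (On0 W a)" "b \<in> Ob A"
    "y \<in> Ob (On0 W b)" "f \<in> Hom A a b" "\<phi> \<in> Hom (On0 W b) (wt_ob f x) y"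
  using assms by (auto simp: El_Hom_iff El_Ar_def elements_ob_def)

lemma Gam_simps [simp]:
  "Ob (Gam A W) = elements_ob A W" "Ar (Gam A W) = Gam_Ar A W" "Dom (Gam A W) = fsrc"
  "Cod (Gam A W) = ftgt" "Idn (Gam A W) = el_idn A W" "Cmp (Gam A W) = Gam_cmp A W"
  by (simp_all add: Gam_def)

lemma Gam_Hom_iff: "p \<in> Hom (Gam A W) X Y \<longleftrightarrow> p \<in> Gam_Ar A W \<and> fsrc p = X \<and> ftgt p = Y"
  by (simp add: Hom_iff)

lemma Gam_HomE:
  assumes "p \<in> Hom (Gam A W) (x,a) (y,b)"
  obtains f \<phi> where "p = Framed (x,a) (f,\<phi>) (y,b)" "a \<in> Ob A" "x \<in> Ob (On0 W a)" "b \<in> Ob A"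
    "y \<in> Ob (On0 W b)" "f \<in> Hom A a b" "\<phi> \<in> Hom (On0 W b) y (wt_ob f x)"
  using assms by (auto simp: Gam_Hom_iff Gam_Ar_def elements_ob_def)

section \<open>The underlying categories of arrows\<close>

lemma category_El: "category (El A W)"
proof
  fix p q r :: "('o,'a,'x,'y) el_ar" and X Y Z V :: "'x \<times> 'o"
  let ?E = "El A W"
  show "p \<in> Ar ?E \<Longrightarrow> Dom ?E p \<in> Ob ?E" "p \<in> Ar ?E \<Longrightarrow> Cod ?E p \<in> Ob ?E"
    by (auto simp: El_Ar_def)
  show "X \<in> Ob ?E \<Longrightarrow> Idn ?E X \<in> Hom ?E X X"
    by (auto simp: El_Hom_iff el_idn_def elements_ob_def el_idn_Hom S.Idn_Hom)
  obtain x a y b z c v d where XYZV: "X = (x,a)" "Y = (y,b)" "Z = (z,c)" "V = (v,d)"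
    by (metis surj_pair)
  show "q \<cdot>\<^bsub>?E\<^esub> p \<in> Hom ?E X Z" if "p \<in> Hom ?E X Y" "q \<in> Hom ?E Y Z"
  proof -
    obtain f \<phi> where p: "p = Framed (x,a) (f,\<phi>) (y,b)" "a \<in> Ob A" "x \<in> Ob (On0 W a)"
      "f \<in> Hom A a b" "\<phi> \<in> Hom (On0 W b) (wt_ob f x) y"
      using El_HomE \<open>p \<in> _\<close> XYZV by metis
    obtain g \<psi> where q: "q = Framed (y,b) (g,\<psi>) (z,c)" "c \<in> Ob A" "z \<in> Ob (On0 W c)"
      "g \<in> Hom A b c" "\<psi> \<in> Hom (On0 W c) (wt_ob g y) z"
      using El_HomE \<open>q \<in> _\<close> XYZV by metis
    have "\<psi> \<cdot>\<^bsub>On0 W c\<^esub> wt_ar g \<phi> \<in> Hom (On0 W c) (wt_ob (g \<cdot>\<^bsub>A\<^esub> f) x) z"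
      using category.Cmp_Hom[OF wt_category[OF q(2)] wt_ar[OF q(4) p(5)] q(5)]
        wt_Cmp(1)[OF p(4) q(4) p(3)] by simp
    moreover have "g \<cdot>\<^bsub>A\<^esub> f \<in> Hom A a c" using S.Cmp_Hom[OF p(4) q(4)] .
    ultimately show ?thesis
      using p(2,3) q(2,3) by (simp add: p(1) q(1) XYZV El_Hom_iff)
  qed
  show "Idn ?E Y \<cdot>\<^bsub>?E\<^esub> p = p" "p \<cdot>\<^bsub>?E\<^esub> Idn ?E X = p" if "p \<in> Hom ?E X Y"
  proof -
    obtain f \<phi> where p: "p = Framed (x,a) (f,\<phi>) (y,b)" "a \<in> Ob A" "x \<in> Ob (On0 W a)" "b \<in> Ob A"
      "f \<in> Hom A a b" "\<phi> \<in> Hom (On0 W b) (wt_ob f x) y"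
      using El_HomE \<open>p \<in> _\<close> XYZV by metis
    interpret D: category "On0 W b" by (rule wt_category[OF p(4)])
    show "Idn ?E Y \<cdot>\<^bsub>?E\<^esub> p = p" "p \<cdot>\<^bsub>?E\<^esub> Idn ?E X = p"
      \<comment> \<open>On the left \<open>wt_ar (Idn A b)\<close> fixes \<open>\<phi>\<close>; on
        the right \<open>wt_ar f\<close> sends the identity of \<open>x\<close> to the identity of
        \<open>wt_ob f x\<close>.\<close>
      using S.Idn_Cmp[OF p(5)] S.Cmp_Idn[OF p(5)] D.Idn_Cmp[OF p(6)] D.Cmp_Idn[OF p(6)]
        wt_Idn(2)[OF p(4) p(6)] wt_ar_Idn[OF p(5) p(3)]
      by (simp_all add: p(1) XYZV el_idn_def)
  qed
  show "(r \<cdot>\<^bsub>?E\<^esub> q) \<cdot>\<^bsub>?E\<^esub> p = r \<cdot>\<^bsub>?E\<^esub> q \<cdot>\<^bsub>?E\<^esub> p"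
    if "p \<in> Hom ?E X Y" "q \<in> Hom ?E Y Z" "r \<in> Hom ?E Z V"
  proof -
    obtain f \<phi> where p: "p = Framed (x,a) (f,\<phi>) (y,b)"
      "f \<in> Hom A a b" "\<phi> \<in> Hom (On0 W b) (wt_ob f x) y"
      using El_HomE \<open>p \<in> _\<close> XYZV by metis
    obtain g \<psi> where q: "q = Framed (y,b) (g,\<psi>) (z,c)"
      "g \<in> Hom A b c" "\<psi> \<in> Hom (On0 W c) (wt_ob g y) z"
      using El_HomE \<open>q \<in> _\<close> XYZV by metis
    obtain h \<chi> where r: "r = Framed (z,c) (h,\<chi>) (v,d)" "d \<in> Ob A"
      "h \<in> Hom A c d" "\<chi> \<in> Hom (On0 W d) (wt_ob h z) v"
      using El_HomE \<open>r \<in> _\<close> XYZV by metis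
    note g\<phi> = wt_ar[OF q(2) p(3)]
    show ?thesis
      using S.Cmp_assoc[OF p(2) q(2) r(3)] wt_Cmp(2)[OF q(2) r(3) p(3)]
        wt_ar_Cmp[OF r(3) g\<phi> q(3)]
        category.Cmp_assoc[OF wt_category[OF r(2)] wt_ar[OF r(3) g\<phi>] wt_ar[OF r(3) q(3)] r(4)]
      by (simp add: p(1) q(1) r(1) XYZV)
  qed
qed

text \<open>The argument for \<open>El\<close> with every fibre arrow reversed: composites in the
  fibre are formed in the opposite order, so \<open>Cmp_Hom\<close>, \<open>Cmp_assoc\<close> and
  \<open>wt_ar_Cmp\<close> take their arguments the other way round.\<close>

lemma category_Gam: "category (Gam A W)"
proof
  fix p q r :: "('o,'a,'x,'y) el_ar" and X Y Z V :: "'x \<times> 'o"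
  let ?E = "Gam A W"
  show "p \<in> Ar ?E \<Longrightarrow> Dom ?E p \<in> Ob ?E" "p \<in> Ar ?E \<Longrightarrow> Cod ?E p \<in> Ob ?E"
    by (auto simp: Gam_Ar_def)
  show "X \<in> Ob ?E \<Longrightarrow> Idn ?E X \<in> Hom ?E X X"
    by (auto simp: Gam_Hom_iff el_idn_def elements_ob_def el_idn_Hom S.Idn_Hom)
  obtain x a y b z c v d where XYZV: "X = (x,a)" "Y = (y,b)" "Z = (z,c)" "V = (v,d)"
    by (metis surj_pair)
  show "q \<cdot>\<^bsub>?E\<^esub> p \<in> Hom ?E X Z" if "p \<in> Hom ?E X Y" "q \<in> Hom ?E Y Z"
  proof -
    obtain f \<phi> where p: "p = Framed (x,a) (f,\<phi>) (y,b)" "a \<in> Ob A" "x \<in> Ob (On0 W a)"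
      "f \<in> Hom A a b" "\<phi> \<in> Hom (On0 W b) y (wt_ob f x)"
      using Gam_HomE \<open>p \<in> _\<close> XYZV by metis
    obtain g \<psi> where q: "q = Framed (y,b) (g,\<psi>) (z,c)" "c \<in> Ob A" "z \<in> Ob (On0 W c)"
      "g \<in> Hom A b c" "\<psi> \<in> Hom (On0 W c) z (wt_ob g y)"
      using Gam_HomE \<open>q \<in> _\<close> XYZV by metis
    have "wt_ar g \<phi> \<cdot>\<^bsub>On0 W c\<^esub> \<psi> \<in> Hom (On0 W c) z (wt_ob (g \<cdot>\<^bsub>A\<^esub> f) x)"
      using category.Cmp_Hom[OF wt_category[OF q(2)] q(5) wt_ar[OF q(4) p(5)]]
        wt_Cmp(1)[OF p(4) q(4) p(3)] by simp
    moreover have "g \<cdot>\<^bsub>A\<^esub> f \<in> Hom A a c" using S.Cmp_Hom[OF p(4) q(4)] .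
    ultimately show ?thesis
      using p(2,3) q(2,3) by (simp add: p(1) q(1) XYZV Gam_Hom_iff)
  qed
  show "Idn ?E Y \<cdot>\<^bsub>?E\<^esub> p = p" "p \<cdot>\<^bsub>?E\<^esub> Idn ?E X = p" if "p \<in> Hom ?E X Y"
  proof -
    obtain f \<phi> where p: "p = Framed (x,a) (f,\<phi>) (y,b)" "a \<in> Ob A" "x \<in> Ob (On0 W a)" "b \<in> Ob A"
      "f \<in> Hom A a b" "\<phi> \<in> Hom (On0 W b) y (wt_ob f x)"
      using Gam_HomE \<open>p \<in> _\<close> XYZV by metis
    interpret D: category "On0 W b" by (rule wt_category[OF p(4)])
    show "Idn ?E Y \<cdot>\<^bsub>?E\<^esub> p = p" "p \<cdot>\<^bsub>?E\<^esub> Idn ?E X = p"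
      using S.Idn_Cmp[OF p(5)] S.Cmp_Idn[OF p(5)] D.Idn_Cmp[OF p(6)] D.Cmp_Idn[OF p(6)]
        wt_Idn(2)[OF p(4) p(6)] wt_ar_Idn[OF p(5) p(3)]
      by (simp_all add: p(1) XYZV el_idn_def)
  qed
  show "(r \<cdot>\<^bsub>?E\<^esub> q) \<cdot>\<^bsub>?E\<^esub> p = r \<cdot>\<^bsub>?E\<^esub> q \<cdot>\<^bsub>?E\<^esub> p"
    if "p \<in> Hom ?E X Y" "q \<in> Hom ?E Y Z" "r \<in> Hom ?E Z V"
  proof -
    obtain f \<phi> where p: "p = Framed (x,a) (f,\<phi>) (y,b)"
      "f \<in> Hom A a b" "\<phi> \<in> Hom (On0 W b) y (wt_ob f x)"
      using Gam_HomE \<open>p \<in> _\<close> XYZV by metis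
    obtain g \<psi> where q: "q = Framed (y,b) (g,\<psi>) (z,c)"
      "g \<in> Hom A b c" "\<psi> \<in> Hom (On0 W c) z (wt_ob g y)"
      using Gam_HomE \<open>q \<in> _\<close> XYZV by metis
    obtain h \<chi> where r: "r = Framed (z,c) (h,\<chi>) (v,d)" "d \<in> Ob A"
      "h \<in> Hom A c d" "\<chi> \<in> Hom (On0 W d) v (wt_ob h z)"
      using Gam_HomE \<open>r \<in> _\<close> XYZV by metis
    note g\<phi> = wt_ar[OF q(2) p(3)]
    show ?thesis
      using S.Cmp_assoc[OF p(2) q(2) r(3)] wt_Cmp(2)[OF q(2) r(3) p(3)]
        wt_ar_Cmp[OF r(3) q(3) g\<phi>]
        category.Cmp_assoc[OF wt_category[OF r(2)] r(4) wt_ar[OF r(3) q(3)] wt_ar[OF r(3) g\<phi>]]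
      by (simp add: p(1) q(1) r(1) XYZV)
  qed
qed

text \<open>This projection to \<open>A\<close> serves as the functor \<open>P\<close> of
  \<open>two_category_framed_cells\<close>.\<close>

lemma functor_maps_El: "functor_maps (El A W) A snd (\<lambda>p. fst (body p))"
  by (intro functor_maps.intro functor_maps_axioms.intro category_El S.category_axioms)
    (auto simp: El_Hom_iff El_Ar_def elements_ob_def el_idn_def)

lemma functor_maps_Gam: "functor_maps (Gam A W) A snd (\<lambda>p. fst (body p))"
  by (intro functor_maps.intro functor_maps_axioms.intro category_Gam S.category_axioms)
    (auto simp: Gam_Hom_iff Gam_Ar_def elements_ob_def el_idn_def)

section \<open>2-cells and their closure under the operations\<close>

lemma El_CellE:
  assumes "\<sigma> \<in> Cell (El A W)"
  obtains x a f \<phi> g \<psi> y b \<gamma>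
  where "\<sigma> = Framed (Framed (x,a) (f,\<phi>) (y,b)) \<gamma> (Framed (x,a) (g,\<psi>) (y,b))"
    "a \<in> Ob A" "x \<in> Ob (On0 W a)" "b \<in> Ob A" "y \<in> Ob (On0 W b)" "f \<in> Hom A a b" "g \<in> Hom A a b"
    "\<phi> \<in> Hom (On0 W b) (wt_ob f x) y" "\<psi> \<in> Hom (On0 W b) (wt_ob g x) y"
    "\<gamma> \<in> Hom (vertical A) f g" "\<psi> \<cdot>\<^bsub>On0 W b\<^esub> wt_at \<gamma> x = \<phi>"
  using assms by (auto simp: El_def El_Cell_def vertical_Hom_iff)

lemma El_CellI:
  assumes "Framed (x,a) (f,\<phi>) (y,b) \<in> El_Ar A W" "Framed (x,a) (g,\<psi>) (y,b) \<in> El_Ar A W"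
    "\<gamma> \<in> Hom (vertical A) f g" "\<psi> \<cdot>\<^bsub>On0 W b\<^esub> wt_at \<gamma> x = \<phi>"
  shows "Framed (Framed (x,a) (f,\<phi>) (y,b)) \<gamma> (Framed (x,a) (g,\<psi>) (y,b)) \<in> Cell (El A W)"
  using assms by (auto simp: El_def El_Cell_def vertical_Hom_iff)

lemma Gam_CellE:
  assumes "\<sigma> \<in> Cell (Gam A W)"
  obtains x a f \<phi> g \<psi> y b \<gamma>
  where "\<sigma> = Framed (Framed (x,a) (f,\<phi>) (y,b)) \<gamma> (Framed (x,a) (g,\<psi>) (y,b))"
    "a \<in> Ob A" "x \<in> Ob (On0 W a)" "b \<in> Ob A" "y \<in> Ob (On0 W b)" "f \<in> Hom A a b" "g \<in> Hom A a b"
    "\<phi> \<in> Hom (On0 W b) y (wt_ob f x)" "\<psi> \<in> Hom (On0 W b) y (wt_ob g x)"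
    "\<gamma> \<in> Hom (vertical A) f g" "wt_at \<gamma> x \<cdot>\<^bsub>On0 W b\<^esub> \<phi> = \<psi>"
  using assms by (auto simp: Gam_def Gam_Cell_def vertical_Hom_iff)

lemma Gam_CellI:
  assumes "Framed (x,a) (f,\<phi>) (y,b) \<in> Gam_Ar A W" "Framed (x,a) (g,\<psi>) (y,b) \<in> Gam_Ar A W"
    "\<gamma> \<in> Hom (vertical A) f g" "wt_at \<gamma> x \<cdot>\<^bsub>On0 W b\<^esub> \<phi> = \<psi>"
  shows "Framed (Framed (x,a) (f,\<phi>) (y,b)) \<gamma> (Framed (x,a) (g,\<psi>) (y,b)) \<in> Cell (Gam A W)"
  using assms by (auto simp: Gam_def Gam_Cell_def vertical_Hom_iff)

text \<open>\<open>horizontal A\<close> knows only the objects at the ends of a 2-cell, so it gives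
  that the composite is a cell; its source and target arrows come from \<open>Src_HCmp\<close> and
  \<open>Tgt_HCmp\<close>.\<close>

lemma horizontal_typing:
  assumes "\<alpha> \<in> Hom (vertical A) f f'" "\<beta> \<in> Hom (vertical A) g g'" "f \<in> Hom A a b" "g \<in> Hom A b c"
  shows "\<beta> \<star>\<^bsub>A\<^esub> \<alpha> \<in> Hom (vertical A) (g \<cdot>\<^bsub>A\<^esub> f) (g' \<cdot>\<^bsub>A\<^esub> f')"
proof -
  have h: "\<alpha> \<in> Hom (horizontal A) a b" "\<beta> \<in> Hom (horizontal A) b c"
    using assms by (auto simp: vertical_def horizontal_def Hom_iff)
  have "\<beta> \<star>\<^bsub>A\<^esub> \<alpha> \<in> Cell A"
    using category.Cmp_Hom[OF S.horizontal_category h] by (simp add: horizontal_def Hom_iff)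
  then show ?thesis
    using assms S.Src_HCmp[of \<alpha> \<beta>] S.Tgt_HCmp[of \<alpha> \<beta>] by (simp add: vertical_Hom_iff) (simp add: Hom_iff)
qed

text \<open>The work lies in the closure of the condition \<psi> after (W\<gamma>)_x = \<phi> under
  identity cells, vertical and horizontal composition.\<close>

lemma two_category_El: "two_category (El A W)"
proof (rule two_category_framed_cells[OF S.two_category_axioms functor_maps_El])
  show "Src (El A W) = fsrc" "Tgt (El A W) = ftgt"
    "VIdn (El A W) = (\<lambda>p. Framed p (VIdn A (fst (body p))) p)"
    "VCmp (El A W) = (\<lambda>\<tau> \<sigma>. Framed (fsrc \<sigma>) (body \<tau> \<bullet>\<^bsub>A\<^esub> body \<sigma>) (ftgt \<tau>))"
    "HCmp (El A W) = (\<lambda>\<tau> \<sigma>. Framed (fsrc \<tau> \<cdot>\<^bsub>El A W\<^esub> fsrc \<sigma>) (body \<tau> \<star>\<^bsub>A\<^esub> body \<sigma>)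
      (ftgt \<tau> \<cdot>\<^bsub>El A W\<^esub> ftgt \<sigma>))"
    by (simp_all add: El_def)
  show "fsrc \<sigma> \<in> Ar (El A W) \<and> ftgt \<sigma> \<in> Ar (El A W) \<and>
      Dom (El A W) (ftgt \<sigma>) = Dom (El A W) (fsrc \<sigma>) \<and>
      Cod (El A W) (ftgt \<sigma>) = Cod (El A W) (fsrc \<sigma>) \<and>
      body \<sigma> \<in> Hom (vertical A) (fst (body (fsrc \<sigma>))) (fst (body (ftgt \<sigma>)))"
    if "\<sigma> \<in> Cell (El A W)" for \<sigma>
    using that by (elim El_CellE) simp
  show "VIdn (El A W) p \<in> Cell (El A W)" if pE: "p \<in> Ar (El A W)" for p
  proof -
    obtain x a y b where "p \<in> Hom (El A W) (x,a) (y,b)"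
      using pE by (auto simp: El_Hom_iff El_Ar_def)
    then obtain f \<phi> where p: "p = Framed (x,a) (f,\<phi>) (y,b)" "a \<in> Ob A" "x \<in> Ob (On0 W a)"
      "b \<in> Ob A" "f \<in> Hom A a b" "\<phi> \<in> Hom (On0 W b) (wt_ob f x) y" and py: "y \<in> Ob (On0 W b)"
      using El_HomE by metis
    interpret D: category "On0 W b" by (rule wt_category[OF p(4)])
    have "VIdn A f \<in> Hom (vertical A) f f"
      using category.Idn_Hom[OF S.vertical_category, of f] p(5) by (simp add: vertical_def Hom_iff)
    \<comment> \<open>The component of the identity cell at \<open>x\<close> is an identity, so the
      condition becomes the right unit law for \<open>\<phi>\<close>.\<close>
    then have "Framed p (VIdn A f) p \<in> Cell (El A W)"
      unfolding p(1) using wt_at_VIdn[OF p(5,3)] D.Cmp_Idn[OF p(6)] p py by (intro El_CellI) simp_all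
    then show ?thesis by (simp add: El_def p(1))
  qed
  show "\<tau> \<bullet>\<^bsub>El A W\<^esub> \<sigma> \<in> Cell (El A W)"
    if \<sigma>: "\<sigma> \<in> Cell (El A W)" and \<tau>: "\<tau> \<in> Cell (El A W)" and e: "fsrc \<tau> = ftgt \<sigma>" for \<sigma> \<tau>
  proof -
    from \<sigma> obtain x a f \<phi> g \<psi> y b \<gamma> where
      s: "\<sigma> = Framed (Framed (x,a) (f,\<phi>) (y,b)) \<gamma> (Framed (x,a) (g,\<psi>) (y,b))"
      and ob: "a \<in> Ob A" "x \<in> Ob (On0 W a)" "b \<in> Ob A" "y \<in> Ob (On0 W b)"
      and f: "f \<in> Hom A a b" and g: "g \<in> Hom A a b"
      and \<phi>: "\<phi> \<in> Hom (On0 W b) (wt_ob f x) y" and \<psi>: "\<psi> \<in> Hom (On0 W b) (wt_ob g x) y"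
      and \<gamma>: "\<gamma> \<in> Hom (vertical A) f g" and \<gamma>e: "\<psi> \<cdot>\<^bsub>On0 W b\<^esub> wt_at \<gamma> x = \<phi>"
      by (rule El_CellE)
    \<comment> \<open>The shared middle frame forces the source of \<open>\<tau>\<close> to be the
      target of \<open>\<sigma>\<close>, so only the target arrow and the cell of
      \<open>\<tau>\<close> are new.\<close>
    from \<tau> e s obtain h \<chi> \<delta> where
      t: "\<tau> = Framed (Framed (x,a) (g,\<psi>) (y,b)) \<delta> (Framed (x,a) (h,\<chi>) (y,b))"
      and h: "h \<in> Hom A a b" and \<chi>: "\<chi> \<in> Hom (On0 W b) (wt_ob h x) y"
      and \<delta>: "\<delta> \<in> Hom (vertical A) g h" and \<delta>e: "\<chi> \<cdot>\<^bsub>On0 W b\<^esub> wt_at \<delta> x = \<psi>"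
      by (elim El_CellE) auto
    interpret D: category "On0 W b" by (rule wt_category[OF ob(3)])
    have "\<chi> \<cdot>\<^bsub>On0 W b\<^esub> wt_at (\<delta> \<bullet>\<^bsub>A\<^esub> \<gamma>) x = \<phi>"
      using wt_at_VCmp[OF \<gamma> \<delta> f ob(2)] D.Cmp_assoc[OF wt_at[OF \<gamma> f ob(2)] wt_at[OF \<delta> g ob(2)] \<chi>]
        \<gamma>e \<delta>e by simp
    moreover have "\<delta> \<bullet>\<^bsub>A\<^esub> \<gamma> \<in> Hom (vertical A) f h"
      using category.Cmp_Hom[OF S.vertical_category \<gamma> \<delta>] by (simp add: vertical_def)
    ultimately have "Framed (Framed (x,a) (f,\<phi>) (y,b)) (\<delta> \<bullet>\<^bsub>A\<^esub> \<gamma>) (Framed (x,a) (h,\<chi>) (y,b)) \<in> Cell (El A W)"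
      using ob f h \<phi> \<chi> by (intro El_CellI) simp_all
    then show ?thesis by (simp add: El_def s t)
  qed
  show "\<tau> \<star>\<^bsub>El A W\<^esub> \<sigma> \<in> Cell (El A W)"
    if \<sigma>: "\<sigma> \<in> Cell (El A W)" and \<tau>: "\<tau> \<in> Cell (El A W)"
      and e: "Dom (El A W) (fsrc \<tau>) = Cod (El A W) (fsrc \<sigma>)" for \<sigma> \<tau>
  proof -
    from \<sigma> obtain x a f \<phi> f' \<phi>' y b \<alpha> where
      s: "\<sigma> = Framed (Framed (x,a) (f,\<phi>) (y,b)) \<alpha> (Framed (x,a) (f',\<phi>') (y,b))"
      and ob: "a \<in> Ob A" "x \<in> Ob (On0 W a)" "b \<in> Ob A" "y \<in> Ob (On0 W b)"
      and f: "f \<in> Hom A a b" and f': "f' \<in> Hom A a b"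
      and \<phi>: "\<phi> \<in> Hom (On0 W b) (wt_ob f x) y" and \<phi>': "\<phi>' \<in> Hom (On0 W b) (wt_ob f' x) y"
      and \<alpha>: "\<alpha> \<in> Hom (vertical A) f f'" and \<alpha>e: "\<phi>' \<cdot>\<^bsub>On0 W b\<^esub> wt_at \<alpha> x = \<phi>"
      by (rule El_CellE)
    from \<tau> e s obtain z c g \<psi> g' \<psi>' \<beta> where
      t: "\<tau> = Framed (Framed (y,b) (g,\<psi>) (z,c)) \<beta> (Framed (y,b) (g',\<psi>') (z,c))"
      and oc: "c \<in> Ob A" "z \<in> Ob (On0 W c)"
      and g: "g \<in> Hom A b c" and g': "g' \<in> Hom A b c"
      and \<psi>: "\<psi> \<in> Hom (On0 W c) (wt_ob g y) z" and \<psi>': "\<psi>' \<in> Hom (On0 W c) (wt_ob g' y) z"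
      and \<beta>: "\<beta> \<in> Hom (vertical A) g g'" and \<beta>e: "\<psi>' \<cdot>\<^bsub>On0 W c\<^esub> wt_at \<beta> y = \<psi>"
      by (elim El_CellE) auto
    interpret D: category "On0 W c" by (rule wt_category[OF oc(1)])
    let ?w = "wt_ob f' x"
    note \<alpha>x = wt_at[OF \<alpha> f ob(2)]
    note \<beta>w = wt_at[OF \<beta> g wt_ob[OF f' ob(2)]] and \<beta>y = wt_at[OF \<beta> g ob(4)]
    note g\<alpha> = wt_ar[OF g \<alpha>x] and g\<phi>' = wt_ar[OF g \<phi>'] and g'\<phi>' = wt_ar[OF g' \<phi>']
    \<comment> \<open>The horizontal component is expanded and rebracketed so that Wg'(\<phi>')
      meets the component of W\<beta> at \<open>?w\<close>, ready for naturality.\<close>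
    have "(\<psi>' \<cdot>\<^bsub>On0 W c\<^esub> wt_ar g' \<phi>') \<cdot>\<^bsub>On0 W c\<^esub> wt_at (\<beta> \<star>\<^bsub>A\<^esub> \<alpha>) x
        = \<psi>' \<cdot>\<^bsub>On0 W c\<^esub> ((wt_ar g' \<phi>' \<cdot>\<^bsub>On0 W c\<^esub> wt_at \<beta> ?w) \<cdot>\<^bsub>On0 W c\<^esub> wt_ar g (wt_at \<alpha> x))"
      using wt_at_HCmp[OF \<alpha> \<beta> f g ob(2)] D.Cmp_assoc[OF D.Cmp_Hom[OF g\<alpha> \<beta>w] g'\<phi>' \<psi>']
        D.Cmp_assoc[OF g\<alpha> \<beta>w g'\<phi>'] by simp
    \<comment> \<open>Naturality of W\<beta> at \<open>\<phi>'\<close> moves its component from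
      \<open>?w\<close> to \<open>y\<close>; the condition on \<open>\<alpha>\<close>, transported
      by \<open>wt_ar g\<close>, then contracts the rest to \<open>wt_ar g \<phi>\<close>. The
      condition on \<open>\<beta>\<close> finishes the calculation.\<close>
    also have "\<dots> = \<psi>' \<cdot>\<^bsub>On0 W c\<^esub> (wt_at \<beta> y \<cdot>\<^bsub>On0 W c\<^esub> wt_ar g \<phi>)"
      using wt_natural[OF \<beta> g \<phi>'] D.Cmp_assoc[OF g\<alpha> g\<phi>' \<beta>y] wt_ar_Cmp[OF g \<alpha>x \<phi>'] \<alpha>e by simp
    also have "\<dots> = \<psi> \<cdot>\<^bsub>On0 W c\<^esub> wt_ar g \<phi>"
      using D.Cmp_assoc[OF wt_ar[OF g \<phi>] \<beta>y \<psi>'] \<beta>e by simp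
    finally have eq: "(\<psi>' \<cdot>\<^bsub>On0 W c\<^esub> wt_ar g' \<phi>') \<cdot>\<^bsub>On0 W c\<^esub> wt_at (\<beta> \<star>\<^bsub>A\<^esub> \<alpha>) x = \<psi> \<cdot>\<^bsub>On0 W c\<^esub> wt_ar g \<phi>" .
    have "Framed (Framed (x,a) (g \<cdot>\<^bsub>A\<^esub> f, \<psi> \<cdot>\<^bsub>On0 W c\<^esub> wt_ar g \<phi>) (z,c)) (\<beta> \<star>\<^bsub>A\<^esub> \<alpha>)
        (Framed (x,a) (g' \<cdot>\<^bsub>A\<^esub> f', \<psi>' \<cdot>\<^bsub>On0 W c\<^esub> wt_ar g' \<phi>') (z,c)) \<in> Cell (El A W)"
      using ob oc S.Cmp_Hom[OF f g] S.Cmp_Hom[OF f' g'] horizontal_typing[OF \<alpha> \<beta> f g] eq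
        D.Cmp_Hom[OF wt_ar[OF g \<phi>] \<psi>] D.Cmp_Hom[OF g'\<phi>' \<psi>']
        wt_Cmp(1)[OF f g ob(2)] wt_Cmp(1)[OF f' g' ob(2)]
      by (intro El_CellI) simp_all
    then show ?thesis by (simp add: El_def s t)
  qed
qed

lemma two_category_Gam: "two_category (Gam A W)"
proof (rule two_category_framed_cells[OF S.two_category_axioms functor_maps_Gam])
  show "Src (Gam A W) = fsrc" "Tgt (Gam A W) = ftgt"
    "VIdn (Gam A W) = (\<lambda>p. Framed p (VIdn A (fst (body p))) p)"
    "VCmp (Gam A W) = (\<lambda>\<tau> \<sigma>. Framed (fsrc \<sigma>) (body \<tau> \<bullet>\<^bsub>A\<^esub> body \<sigma>) (ftgt \<tau>))"
    "HCmp (Gam A W) = (\<lambda>\<tau> \<sigma>. Framed (fsrc \<tau> \<cdot>\<^bsub>Gam A W\<^esub> fsrc \<sigma>) (body \<tau> \<star>\<^bsub>A\<^esub> body \<sigma>)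
      (ftgt \<tau> \<cdot>\<^bsub>Gam A W\<^esub> ftgt \<sigma>))"
    by (simp_all add: Gam_def)
  show "fsrc \<sigma> \<in> Ar (Gam A W) \<and> ftgt \<sigma> \<in> Ar (Gam A W) \<and>
      Dom (Gam A W) (ftgt \<sigma>) = Dom (Gam A W) (fsrc \<sigma>) \<and>
      Cod (Gam A W) (ftgt \<sigma>) = Cod (Gam A W) (fsrc \<sigma>) \<and>
      body \<sigma> \<in> Hom (vertical A) (fst (body (fsrc \<sigma>))) (fst (body (ftgt \<sigma>)))"
    if "\<sigma> \<in> Cell (Gam A W)" for \<sigma>
    using that by (elim Gam_CellE) simp
  show "VIdn (Gam A W) p \<in> Cell (Gam A W)" if pE: "p \<in> Ar (Gam A W)" for p
  proof -
    obtain x a y b where "p \<in> Hom (Gam A W) (x,a) (y,b)"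
      using pE by (auto simp: Gam_Hom_iff Gam_Ar_def)
    then obtain f \<phi> where p: "p = Framed (x,a) (f,\<phi>) (y,b)" "a \<in> Ob A" "x \<in> Ob (On0 W a)"
      "b \<in> Ob A" "f \<in> Hom A a b" "\<phi> \<in> Hom (On0 W b) y (wt_ob f x)" and py: "y \<in> Ob (On0 W b)"
      using Gam_HomE by metis
    interpret D: category "On0 W b" by (rule wt_category[OF p(4)])
    have "VIdn A f \<in> Hom (vertical A) f f"
      using category.Idn_Hom[OF S.vertical_category, of f] p(5) by (simp add: vertical_def Hom_iff)
    \<comment> \<open>In the dual the identity component stands after \<open>\<phi>\<close>, so the
      left unit law applies.\<close>
    then have "Framed p (VIdn A f) p \<in> Cell (Gam A W)"
      unfolding p(1) using wt_at_VIdn[OF p(5,3)] D.Idn_Cmp[OF p(6)] p py by (intro Gam_CellI) simp_all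
    then show ?thesis by (simp add: Gam_def p(1))
  qed
  show "\<tau> \<bullet>\<^bsub>Gam A W\<^esub> \<sigma> \<in> Cell (Gam A W)"
    if \<sigma>: "\<sigma> \<in> Cell (Gam A W)" and \<tau>: "\<tau> \<in> Cell (Gam A W)" and e: "fsrc \<tau> = ftgt \<sigma>" for \<sigma> \<tau>
  proof -
    from \<sigma> obtain x a f \<phi> g \<psi> y b \<gamma> where
      s: "\<sigma> = Framed (Framed (x,a) (f,\<phi>) (y,b)) \<gamma> (Framed (x,a) (g,\<psi>) (y,b))"
      and ob: "a \<in> Ob A" "x \<in> Ob (On0 W a)" "b \<in> Ob A" "y \<in> Ob (On0 W b)"
      and f: "f \<in> Hom A a b" and g: "g \<in> Hom A a b"
      and \<phi>: "\<phi> \<in> Hom (On0 W b) y (wt_ob f x)" and \<psi>: "\<psi> \<in> Hom (On0 W b) y (wt_ob g x)"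
      and \<gamma>: "\<gamma> \<in> Hom (vertical A) f g" and \<gamma>e: "wt_at \<gamma> x \<cdot>\<^bsub>On0 W b\<^esub> \<phi> = \<psi>"
      by (rule Gam_CellE)
    from \<tau> e s obtain h \<chi> \<delta> where
      t: "\<tau> = Framed (Framed (x,a) (g,\<psi>) (y,b)) \<delta> (Framed (x,a) (h,\<chi>) (y,b))"
      and h: "h \<in> Hom A a b" and \<chi>: "\<chi> \<in> Hom (On0 W b) y (wt_ob h x)"
      and \<delta>: "\<delta> \<in> Hom (vertical A) g h" and \<delta>e: "wt_at \<delta> x \<cdot>\<^bsub>On0 W b\<^esub> \<psi> = \<chi>"
      by (elim Gam_CellE) auto
    interpret D: category "On0 W b" by (rule wt_category[OF ob(3)])
    have "wt_at (\<delta> \<bullet>\<^bsub>A\<^esub> \<gamma>) x \<cdot>\<^bsub>On0 W b\<^esub> \<phi> = \<chi>"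
      using wt_at_VCmp[OF \<gamma> \<delta> f ob(2)] D.Cmp_assoc[OF \<phi> wt_at[OF \<gamma> f ob(2)] wt_at[OF \<delta> g ob(2)]]
        \<gamma>e \<delta>e by simp
    moreover have "\<delta> \<bullet>\<^bsub>A\<^esub> \<gamma> \<in> Hom (vertical A) f h"
      using category.Cmp_Hom[OF S.vertical_category \<gamma> \<delta>] by (simp add: vertical_def)
    ultimately have "Framed (Framed (x,a) (f,\<phi>) (y,b)) (\<delta> \<bullet>\<^bsub>A\<^esub> \<gamma>) (Framed (x,a) (h,\<chi>) (y,b)) \<in> Cell (Gam A W)"
      using ob f h \<phi> \<chi> by (intro Gam_CellI) simp_all
    then show ?thesis by (simp add: Gam_def s t)
  qed
  show "\<tau> \<star>\<^bsub>Gam A W\<^esub> \<sigma> \<in> Cell (Gam A W)"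
    if \<sigma>: "\<sigma> \<in> Cell (Gam A W)" and \<tau>: "\<tau> \<in> Cell (Gam A W)"
      and e: "Dom (Gam A W) (fsrc \<tau>) = Cod (Gam A W) (fsrc \<sigma>)" for \<sigma> \<tau>
  proof -
    from \<sigma> obtain x a f \<phi> f' \<phi>' y b \<alpha> where
      s: "\<sigma> = Framed (Framed (x,a) (f,\<phi>) (y,b)) \<alpha> (Framed (x,a) (f',\<phi>') (y,b))"
      and ob: "a \<in> Ob A" "x \<in> Ob (On0 W a)" "b \<in> Ob A" "y \<in> Ob (On0 W b)"
      and f: "f \<in> Hom A a b" and f': "f' \<in> Hom A a b"
      and \<phi>: "\<phi> \<in> Hom (On0 W b) y (wt_ob f x)" and \<phi>': "\<phi>' \<in> Hom (On0 W b) y (wt_ob f' x)"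
      and \<alpha>: "\<alpha> \<in> Hom (vertical A) f f'" and \<alpha>e: "wt_at \<alpha> x \<cdot>\<^bsub>On0 W b\<^esub> \<phi> = \<phi>'"
      by (rule Gam_CellE)
    from \<tau> e s obtain z c g \<psi> g' \<psi>' \<beta> where
      t: "\<tau> = Framed (Framed (y,b) (g,\<psi>) (z,c)) \<beta> (Framed (y,b) (g',\<psi>') (z,c))"
      and oc: "c \<in> Ob A" "z \<in> Ob (On0 W c)"
      and g: "g \<in> Hom A b c" and g': "g' \<in> Hom A b c"
      and \<psi>: "\<psi> \<in> Hom (On0 W c) z (wt_ob g y)" and \<psi>': "\<psi>' \<in> Hom (On0 W c) z (wt_ob g' y)"
      and \<beta>: "\<beta> \<in> Hom (vertical A) g g'" and \<beta>e: "wt_at \<beta> y \<cdot>\<^bsub>On0 W c\<^esub> \<psi> = \<psi>'"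
      by (elim Gam_CellE) auto
    interpret D: category "On0 W c" by (rule wt_category[OF oc(1)])
    let ?w = "wt_ob f' x"
    note \<alpha>x = wt_at[OF \<alpha> f ob(2)]
    note \<beta>w = wt_at[OF \<beta> g wt_ob[OF f' ob(2)]] and \<beta>y = wt_at[OF \<beta> g ob(4)]
    note g\<alpha> = wt_ar[OF g \<alpha>x] and g\<phi> = wt_ar[OF g \<phi>] and g\<phi>' = wt_ar[OF g \<phi>']
      and g'\<phi>' = wt_ar[OF g' \<phi>']
    \<comment> \<open>The dual calculation uses the same ingredients in another order: here Wg of
      the component of W\<alpha> meets Wg(\<phi>), so the condition on \<open>\<alpha>\<close> comes
      first, then naturality of W\<beta> at \<open>\<phi>'\<close> together with the condition on
      \<open>\<beta>\<close>.\<close>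
    have "wt_at (\<beta> \<star>\<^bsub>A\<^esub> \<alpha>) x \<cdot>\<^bsub>On0 W c\<^esub> (wt_ar g \<phi> \<cdot>\<^bsub>On0 W c\<^esub> \<psi>)
        = wt_at \<beta> ?w \<cdot>\<^bsub>On0 W c\<^esub> ((wt_ar g (wt_at \<alpha> x) \<cdot>\<^bsub>On0 W c\<^esub> wt_ar g \<phi>) \<cdot>\<^bsub>On0 W c\<^esub> \<psi>)"
      using wt_at_HCmp[OF \<alpha> \<beta> f g ob(2)] D.Cmp_assoc[OF D.Cmp_Hom[OF \<psi> g\<phi>] g\<alpha> \<beta>w]
        D.Cmp_assoc[OF \<psi> g\<phi> g\<alpha>] by simp
    also have "\<dots> = (wt_at \<beta> ?w \<cdot>\<^bsub>On0 W c\<^esub> wt_ar g \<phi>') \<cdot>\<^bsub>On0 W c\<^esub> \<psi>"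
      using wt_ar_Cmp[OF g \<phi> \<alpha>x] \<alpha>e D.Cmp_assoc[OF \<psi> g\<phi>' \<beta>w] by simp
    also have "\<dots> = wt_ar g' \<phi>' \<cdot>\<^bsub>On0 W c\<^esub> \<psi>'"
      using wt_natural[OF \<beta> g \<phi>'] D.Cmp_assoc[OF \<psi> \<beta>y g'\<phi>'] \<beta>e by simp
    finally have eq: "wt_at (\<beta> \<star>\<^bsub>A\<^esub> \<alpha>) x \<cdot>\<^bsub>On0 W c\<^esub> (wt_ar g \<phi> \<cdot>\<^bsub>On0 W c\<^esub> \<psi>) = wt_ar g' \<phi>' \<cdot>\<^bsub>On0 W c\<^esub> \<psi>'" .
    have "Framed (Framed (x,a) (g \<cdot>\<^bsub>A\<^esub> f, wt_ar g \<phi> \<cdot>\<^bsub>On0 W c\<^esub> \<psi>) (z,c)) (\<beta> \<star>\<^bsub>A\<^esub> \<alpha>)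
        (Framed (x,a) (g' \<cdot>\<^bsub>A\<^esub> f', wt_ar g' \<phi>' \<cdot>\<^bsub>On0 W c\<^esub> \<psi>') (z,c)) \<in> Cell (Gam A W)"
      using ob oc S.Cmp_Hom[OF f g] S.Cmp_Hom[OF f' g'] horizontal_typing[OF \<alpha> \<beta> f g] eq
        D.Cmp_Hom[OF \<psi> g\<phi>] D.Cmp_Hom[OF \<psi>' g'\<phi>']
        wt_Cmp(1)[OF f g ob(2)] wt_Cmp(1)[OF f' g' ob(2)]
      by (intro Gam_CellI) simp_all
    then show ?thesis by (simp add: Gam_def s t)
  qed
qed


section \<open>The arrows with identity fibre component\<close>

text \<open>The identity is taken at the target object. When Wf(x) = y it points both from Wf(x) to
  y and back, so one map serves \<open>El\<close> and \<open>Gam\<close>.\<close>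

definition strict_ar :: "('x \<times> 'o, 'a) framed \<Rightarrow> ('o,'a,'x,'y) el_ar" where
  "strict_ar p = Framed (fsrc p) (body p, Idn (On0 W (snd (ftgt p))) (fst (ftgt p))) (ftgt p)"

lemma elements_cat_Ar_iff:
  "Framed (x,a) f (y,b) \<in> Ar (elements_cat A W) \<longleftrightarrow>
     a \<in> Ob A \<and> x \<in> Ob (On0 W a) \<and> b \<in> Ob A \<and> f \<in> Hom A a b \<and> wt_ob f x = y"
  using wt_ob by (auto simp: elements_cat_def elements_ob_def)

lemma elements_cat_ArE:
  assumes "p \<in> Ar (elements_cat A W)"
  obtains x a f b where "p = Framed (x,a) f (wt_ob f x,b)" "a \<in> Ob A" "x \<in> Ob (On0 W a)"
    "b \<in> Ob A" "f \<in> Hom A a b"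
  using assms by (auto simp: elements_cat_def elements_ob_def)

text \<open>An identity arrow at z that is typed between Wf(x) and y, in either direction, forces
  both to equal z.\<close>

lemma id_arrows_eq:
  shows "id_arrows W (El A W) = strict_ar ` Ar (elements_cat A W)"
    and "id_arrows W (Gam A W) = strict_ar ` Ar (elements_cat A W)"
proof -
  have idn: "u = y \<and> v = y" if "Idn (On0 W b) y \<in> Hom (On0 W b) u v" "b \<in> Ob A" "y \<in> Ob (On0 W b)" for u v y b
    using that category.Idn_Hom[OF wt_category[OF that(2)] that(3)] by (auto simp: Hom_iff)
  have mem: "strict_ar p \<in> id_arrows W (El A W) \<and> strict_ar p \<in> id_arrows W (Gam A W)"
    if "p \<in> Ar (elements_cat A W)" for p
    using that
  proof (rule elements_cat_ArE)
    fix x a f b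
    assume p: "p = Framed (x,a) f (wt_ob f x,b)" "a \<in> Ob A" "x \<in> Ob (On0 W a)" "b \<in> Ob A" "f \<in> Hom A a b"
    show ?thesis
      unfolding id_arrows_def
      using p wt_ob[OF p(5,3)] category.Idn_Hom[OF wt_category[OF p(4)] wt_ob[OF p(5,3)]]
      by (auto simp: strict_ar_def El_def Gam_def)
  qed
  have "q \<in> strict_ar ` Ar (elements_cat A W)" if "q \<in> id_arrows W (El A W) \<or> q \<in> id_arrows W (Gam A W)" for q
  proof -
    \<comment> \<open>\<open>id_arrows\<close> allows an identity at any object \<open>z\<close> of
      the fibre over \<open>b\<close>; that \<open>z\<close> is \<open>y\<close> is derived below
      from the typing of \<open>q\<close>.\<close>
    from that obtain x a f y b z where q: "q = Framed (x,a) (f, Idn (On0 W b) z) (y,b)"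
      and z: "z \<in> Ob (On0 W b)"
      and ar: "q \<in> El_Ar A W \<or> q \<in> Gam_Ar A W"
      by (auto simp: id_arrows_def El_def Gam_def)
    have o: "a \<in> Ob A" "x \<in> Ob (On0 W a)" "b \<in> Ob A" "f \<in> Hom A a b"
      using ar by (auto simp: q)
    have "wt_ob f x = z \<and> y = z"
      using ar idn[OF _ o(3) z] by (auto simp: q)
    then have "Framed (x,a) f (y,b) \<in> Ar (elements_cat A W)" "q = strict_ar (Framed (x,a) f (y,b))"
      using o by (auto simp: elements_cat_Ar_iff q strict_ar_def)
    then show ?thesis by blast
  qed
  then show "id_arrows W (El A W) = strict_ar ` Ar (elements_cat A W)"
    "id_arrows W (Gam A W) = strict_ar ` Ar (elements_cat A W)"
    using mem by blast+
qed

lemma strict_ar_Idn: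
  assumes "X \<in> elements_ob A W"
  shows "el_idn A W X \<in> strict_ar ` Ar (elements_cat A W)"
proof -
  obtain x a where X: "X = (x,a)" "a \<in> Ob A" "x \<in> Ob (On0 W a)"
    using assms by (auto simp: elements_ob_def)
  then have "Framed (x,a) (Idn A a) (x,a) \<in> Ar (elements_cat A W)"
    using S.Idn_Hom wt_Idn(1) by (simp add: elements_cat_Ar_iff)
  moreover have "el_idn A W X = strict_ar (Framed (x,a) (Idn A a) (x,a))"
    by (simp add: X el_idn_def strict_ar_def)
  ultimately show ?thesis by blast
qed

text \<open>Wg preserves identities, so in either order of composition the fibre component is an
  identity composed with itself. Both composites are thus the image of the same arrow
  \<open>?r\<close>.\<close>

lemma strict_ar_Cmp:
  assumes "p \<in> Ar (elements_cat A W)" "q \<in> Ar (elements_cat A W)" "fsrc q = ftgt p"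
  shows "El_cmp A W (strict_ar q) (strict_ar p) \<in> strict_ar ` Ar (elements_cat A W)"
    and "Gam_cmp A W (strict_ar q) (strict_ar p) \<in> strict_ar ` Ar (elements_cat A W)"
proof -
  obtain x a f b where p: "p = Framed (x,a) f (wt_ob f x,b)" "a \<in> Ob A" "x \<in> Ob (On0 W a)"
    "b \<in> Ob A" "f \<in> Hom A a b"
    using assms(1) by (rule elements_cat_ArE)
  define y where "y = wt_ob f x"
  have y: "y \<in> Ob (On0 W b)" using wt_ob[OF p(5,3)] by (simp add: y_def)
  obtain g c where q: "q = Framed (y,b) g (wt_ob g y,c)" "c \<in> Ob A" "g \<in> Hom A b c"
    using assms(2,3) p(1) by (auto simp: y_def elim: elements_cat_ArE)
  have z: "wt_ob g y \<in> Ob (On0 W c)" using wt_ob[OF q(3) y] .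
  interpret D: category "On0 W c" by (rule wt_category[OF q(2)])
  let ?r = "Framed (x,a) (g \<cdot>\<^bsub>A\<^esub> f) (wt_ob g y,c)"
  have "?r \<in> Ar (elements_cat A W)"
    using p q(2) S.Cmp_Hom[OF p(5) q(3)] wt_Cmp(1)[OF p(5) q(3) p(3)]
    by (simp add: elements_cat_Ar_iff y_def)
  moreover have "El_cmp A W (strict_ar q) (strict_ar p) = strict_ar ?r"
    "Gam_cmp A W (strict_ar q) (strict_ar p) = strict_ar ?r"
    using wt_ar_Idn[OF q(3) y] D.Idn_Cmp[OF D.Idn_Hom[OF z]]
    by (simp_all add: p(1) q(1) strict_ar_def y_def[symmetric])
  ultimately show "El_cmp A W (strict_ar q) (strict_ar p) \<in> strict_ar ` Ar (elements_cat A W)"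
    "Gam_cmp A W (strict_ar q) (strict_ar p) \<in> strict_ar ` Ar (elements_cat A W)"
    by simp_all
qed

section \<open>The PIE property\<close>

text \<open>Treats \<open>El\<close> and \<open>Gam\<close> at once: of \<open>C\<close> it asks
  only the features they share, namely the objects, ends and identities, and strict arrows that
  belong to \<open>C\<close> and are closed under composition.\<close>

lemma PIE_indexing_pair_strict_ar:
  fixes C :: "('x \<times> 'o, ('o,'a,'x,'y) el_ar, 'e) two_cat"
  assumes "two_category C" "Ob C = elements_ob A W" "Dom C = fsrc" "Cod C = ftgt"
    and "Idn C = el_idn A W" "strict_ar ` Ar (elements_cat A W) \<subseteq> Ar C"
    and Cmp: "\<And>p q. \<lbrakk>p \<in> Ar (elements_cat A W); q \<in> Ar (elements_cat A W); fsrc q = ftgt p\<rbrakk>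
      \<Longrightarrow> strict_ar q \<cdot>\<^bsub>C\<^esub> strict_ar p \<in> strict_ar ` Ar (elements_cat A W)"
    and PIE: "PIE_weight A W"
  shows "PIE_indexing_pair C (strict_ar ` Ar (elements_cat A W))"
proof -
  have ends [simp]: "fsrc (strict_ar p) = fsrc p" "ftgt (strict_ar p) = ftgt p" for p
    by (simp_all add: strict_ar_def)
  have inj: "inj_on strict_ar B" for B
    by (auto simp: inj_on_def strict_ar_def intro: framed.expand)
  have "indexing_pair C (strict_ar ` Ar (elements_cat A W))"
    using assms strict_ar_Idn by (auto simp: indexing_pair_def)
  moreover have "components_have_initial (arrow_subcategory C (strict_ar ` Ar (elements_cat A W)))"
  proof (rule components_have_initial_transfer)
    show "components_have_initial (elements_cat A W)"
      using PIE by (simp add: PIE_weight_def)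
    show "Ob (arrow_subcategory C (strict_ar ` Ar (elements_cat A W))) = Ob (elements_cat A W)"
      by (simp add: arrow_subcategory_def elements_cat_def assms)
    \<comment> \<open>\<open>strict_ar\<close> is injective, since it keeps the body as first
      component, and it preserves both ends, so it restricts to a bijection on each hom-set.\<close>
    show "bij_betw strict_ar (Hom (elements_cat A W) X Y)
        (Hom (arrow_subcategory C (strict_ar ` Ar (elements_cat A W))) X Y)" for X Y
      using inj by (auto simp: bij_betw_def Hom_def arrow_subcategory_def elements_cat_def assms(3,4))
  qed
  ultimately show ?thesis by (simp add: PIE_indexing_pair_def)
qed

end

theorem proposition2p11:
  fixes A :: "('o,'a,'c) two_cat" and W :: "('o,'a,'c,'x,'y) weight"
  assumes "two_category A"
    and "two_functor A Cat W"
    and "PIE_weight A W"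
  shows "PIE_indexing_pair (El A W) (id_arrows W (El A W)) \<and>
         PIE_indexing_pair (Gam A W) (id_arrows W (Gam A W))"
proof -
  interpret two_functor A Cat W by fact
  interpret weighted_two_category A W ..
  \<comment> \<open>Rewritten with \<open>id_arrows_eq\<close>, this supplies the inclusion of
    strict arrows that \<open>PIE_indexing_pair_strict_ar\<close> requires.\<close>
  have sub: "id_arrows W C \<subseteq> Ar C" for C
    by (auto simp: id_arrows_def)
  have "PIE_indexing_pair (El A W) (id_arrows W (El A W))"
    unfolding id_arrows_eq(1)
    using assms(3) sub[of "El A W", unfolded id_arrows_eq] strict_ar_Cmp(1)
    by (intro PIE_indexing_pair_strict_ar two_category_El) simp_all
  moreover have "PIE_indexing_pair (Gam A W) (id_arrows W (Gam A W))"
    unfolding id_arrows_eq(2)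
    using assms(3) sub[of "Gam A W", unfolded id_arrows_eq] strict_ar_Cmp(2)
    by (intro PIE_indexing_pair_strict_ar two_category_Gam) simp_all
  ultimately show ?thesis ..
qed

end
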